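(* The following three statistics are equidistributed (for each size $n$) and all have the generating function (exponential in $x$, which marks size $n$, with $y$ marking the statistic) \[\left(\frac{1-y}{2e^{x(y-1)}-1-y}\right)^{1/2}:\] (1) the number of Klazar violators, on increasing ordered trees with $n$ edges; (2) the number of uplines, on perfect matchings of $\{1,\dots,2n\}$ (represented as PM dot diagrams of size $n$); (3) the number of even entries that occur an odd number of times, on trapezoidal words of length $n$.
   Context: An increasing ordered tree with $n$ edges is a rooted ordered (plane) tree with vertices labeled bijectively by $0,1,\dots,n$ so that each child's label exceeds its parent's; vertices are identified with labels. A vertex $v$ is a descent terminator if it has a sibling immediately to its left that is larger than $v$. The big cohort of $v$ is the maximal terminal (rightmost) sublist of the left-to-right list of siblings strictly to the left of $v$ all of whose entries exceed $v$; the associate of a descent terminator $v$ is the smallest entry of its big cohort. A Klazar violator is a descent terminator $v$ whose associate is smaller than every child of $v$ (vacuously true for a leaf). A PM dot diagram of size $n$ represents a perfect matching of $\{1,\dots,2n\}$ by two rows of $n$ dots, the $i$th top dot being $2i-1$ and the $i$th bottom dot $2i$. An upline is a match of the $i$th bottom dot with the $j$th top dot where $i<j$, i.e. an even number matched to a larger odd number. A trapezoidal word of length $n$ is an element $(a_k)_{1\le k\le n}$ of $[1]\times[3]\times\cdots\times[2n-1]$, where $[m]=\{1,\dots,m\}$. "Number of even entries that occur an odd number of times" means the number of distinct even values occurring an odd number of times in the word. For $n=0$ each family has one object, with statistic $0$. *)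

theory Defs
  imports
    "HOL-Library.Disjoint_Sets"
    "HOL-Computational_Algebra.Computational_Algebra"
begin

datatype otree = OTree (root_label: nat) (subtrees: "otree list")

fun labels :: "otree \<Rightarrow> nat list" where
  "labels (OTree u ts) = u # concat (map labels ts)"

fun increasing :: "otree \<Rightarrow> bool" where
  "increasing (OTree u ts) \<longleftrightarrow> (\<forall>t\<in>set ts. u < root_label t \<and> increasing t)"

definition increasing_ordered_trees :: "nat \<Rightarrow> otree set" where
  "increasing_ordered_trees n =
     {t. increasing t \<and> distinct (labels t) \<and> set (labels t) = {0..n}}"

text \<open>
  Vertices are identified with their labels. The next two functions therefore have
  the intended meaning only on trees with pairwise distinct labels: then at most one of the lists joined by
  \<^const>\<open>concat\<close> is nonempty.
\<close>

fun children :: "otree \<Rightarrow> nat \<Rightarrow> nat list" where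
  "children (OTree u ts) v =
     (if v = u then map root_label ts else concat (map (\<lambda>t. children t v) ts))"

text \<open>The siblings strictly to the left of \<open>v\<close>, from left to right (none for the root).\<close>

fun left_siblings :: "otree \<Rightarrow> nat \<Rightarrow> nat list" where
  "left_siblings (OTree u ts) v =
     (if v \<in> set (map root_label ts)
      then takeWhile (\<lambda>w. w \<noteq> v) (map root_label ts)
      else concat (map (\<lambda>t. left_siblings t v) ts))"

definition descent_terminator :: "otree \<Rightarrow> nat \<Rightarrow> bool" where
  "descent_terminator t v \<longleftrightarrow>
     v \<in> set (labels t) \<and> left_siblings t v \<noteq> [] \<and> v < last (left_siblings t v)"

definition big_cohort :: "otree \<Rightarrow> nat \<Rightarrow> nat list" where
  "big_cohort t v = rev (takeWhile (\<lambda>w. v < w) (rev (left_siblings t v)))"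

definition associate :: "otree \<Rightarrow> nat \<Rightarrow> nat" where
  "associate t v = Min (set (big_cohort t v))"

definition klazar_violator :: "otree \<Rightarrow> nat \<Rightarrow> bool" where
  "klazar_violator t v \<longleftrightarrow>
     descent_terminator t v \<and> (\<forall>c\<in>set (children t v). associate t v < c)"

definition num_klazar_violators :: "otree \<Rightarrow> nat" where
  "num_klazar_violators t = card {v \<in> set (labels t). klazar_violator t v}"

definition perfect_matchings :: "nat \<Rightarrow> nat set set set" where
  "perfect_matchings n = {M. partition_on {1..2*n} M \<and> (\<forall>e\<in>M. card e = 2)}"

definition top_dot :: "nat \<Rightarrow> nat" where
  "top_dot i = 2 * i - 1"

definition bottom_dot :: "nat \<Rightarrow> nat" where
  "bottom_dot i = 2 * i"

definition num_uplines :: "nat set set \<Rightarrow> nat" where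
  "num_uplines M = card {e \<in> M. \<exists>i j. 1 \<le> i \<and> i < j \<and> e = {bottom_dot i, top_dot j}}"

text \<open>The 0-based position \<open>k\<close> is the 1-based position \<open>k + 1\<close>, so the bound is \<open>2 (k + 1) - 1\<close>.\<close>

definition trapezoidal_words :: "nat \<Rightarrow> nat list set" where
  "trapezoidal_words n = {w. length w = n \<and> (\<forall>k<n. w ! k \<in> {1..2*k+1})}"

definition num_even_odd_times :: "nat list \<Rightarrow> nat" where
  "num_even_odd_times w = card {a \<in> set w. even a \<and> odd (count_list w a)}"

definition equidistributed ::
  "(nat \<Rightarrow> 'a set) \<Rightarrow> ('a \<Rightarrow> nat) \<Rightarrow> (nat \<Rightarrow> 'b set) \<Rightarrow> ('b \<Rightarrow> nat) \<Rightarrow> bool" where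
  "equidistributed A f B g \<longleftrightarrow>
     (\<forall>n k. card {a \<in> A n. f a = k} = card {b \<in> B n. g b = k})"

text \<open>
  Generating functions live in the ring of formal power series in \<open>x\<close> over the field of rational
  functions in \<open>y\<close> with rational coefficients. Over this field \<open>1 - y\<close> is invertible, which
  makes sense of the quotient in the closed form below.
\<close>

definition gf_y :: "rat poly fract" where
  "gf_y = to_fract [:0, 1:]"

definition stat_gf :: "(nat \<Rightarrow> 'a set) \<Rightarrow> ('a \<Rightarrow> nat) \<Rightarrow> rat poly fract fps" where
  "stat_gf A f = Abs_fps (\<lambda>n. (\<Sum>a\<in>A n. gf_y ^ f a) / fact n)"

text \<open>
  The series \<open>((1 - y) / (2 exp (x (y - 1)) - 1 - y)) ^ (1/2)\<close>. The quotient has constant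
  term 1, and its square root is the one with constant term 1, which is what the
  root function \<open>\<lambda>_ _. 1\<close> for constant terms prescribes.
\<close>

definition closed_form_gf :: "rat poly fract fps" where
  "closed_form_gf =
     fps_radical (\<lambda>_ _. 1) 2
       (fps_const (1 - gf_y) / (2 * fps_exp (gf_y - 1) - 1 - fps_const gf_y))"

end

theory Submission
  imports Defs "HOL-Combinatorics.Transposition"
begin

text \<open>
  All three statistics are counted by one sequence of polynomials, \<open>P\<^sub>0 = 1\<close> and
  \<open>P\<^sub>n\<^sub>+\<^sub>1 = (n + 1 + n y) P\<^sub>n + (1 - y\<^sup>2) P\<^sub>n'\<close>. Applied to \<open>y\<^sup>k\<close>, the operator on
  the right gives \<open>(n + 1) y\<^sup>k + (n - k) y\<^sup>k\<^sup>+\<^sup>1 + k y\<^sup>k\<^sup>-\<^sup>1\<close>. Hence \<open>P\<^sub>n\<close> counts every family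
  in which an object of size \<open>n\<close> with statistic \<open>k\<close> has \<open>2 n + 1\<close> extensions to size \<open>n + 1\<close>,
  of which \<open>n - k\<close> raise the statistic by one, \<open>k\<close> lower it by one and \<open>n + 1\<close> keep it
  (\<open>counted_by_stat_poly_if_balanced_growth\<close>).

  A word grows by a letter, and an even letter flips the parity of its own multiplicity. A
  matching grows by the points \<open>2 n + 1\<close> and \<open>2 n + 2\<close>, which are matched to each other or split
  an existing edge; an upline is created or destroyed according to the parity of the point that
  \<open>2 n + 1\<close> receives. Both are balanced in the above sense.

  A tree grows by the leaf \<open>n + 1\<close>, and here the statistic never decreases, so a second parameter
  is needed. Call a vertex other than the root busy if it has a child or is a descent terminator.
  If the new leaf is placed directly to the left of a vertex that is not busy, this vertex becomes
  busy and a violator; if it becomes the child of such a vertex, the vertex becomes busy only; every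
  other placement changes neither set. So each vertex, when it becomes busy, contributes
  the factor \<open>1 + y\<close>, and \<open>P\<^sub>n\<close> is recovered through its expansion in powers of \<open>1 + y\<close>
  (\<open>sum_child_families\<close>, \<open>stat_poly_eq_sum_tree_coeff\<close>).

  For the generating function let \<open>F\<close> be the closed form. It satisfies
  \<open>2 F' = (1 - y) F + (1 + y) F\<^sup>3\<close>, so its \<open>n\<close>th derivative is a combination of the
  \<open>(1 + y)\<^sup>a (1 - y)\<^sup>n\<^sup>-\<^sup>a F\<^sup>2\<^sup>a\<^sup>+\<^sup>1\<close>. The recurrence for \<open>P\<^sub>n\<close>, written in the basis
  \<open>(1 + y)\<^sup>a (1 - y)\<^sup>n\<^sup>-\<^sup>a\<close>, has the same coefficients, and \<open>F\<close> is \<open>1\<close> at \<open>x = 0\<close>. Therefore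
  \<open>P\<^sub>n\<close> is \<open>n!\<close> times the \<open>n\<close>th coefficient of \<open>F\<close> (\<open>closed_form_nth\<close>).
\<close>

section \<open>The counting polynomials and the closed form\<close>

definition Y :: "rat poly" where
  "Y = [:0, 1:]"

lemma pderiv_Y [simp]: "pderiv Y = 1"
  by (simp add: Y_def pderiv_pCons)

lemma coeff_Y_power: "coeff (Y ^ k) j = (if j = k then 1 else 0)"
proof -
  have "Y ^ k = monom 1 k"
    by (simp add: Y_def monom_altdef)
  then show ?thesis
    by (simp add: coeff_monom)
qed

lemma gf_y_eq: "gf_y = to_fract Y"
  by (simp add: gf_y_def Y_def)

lemma to_fract_power: "to_fract (p ^ k) = to_fract p ^ k"
  by (induction k) simp_all

lemma to_fract_of_nat: "to_fract (of_nat k) = of_nat k"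
  by (induction k) simp_all

text \<open>
  The derivation sends \<open>Y\<^sup>k\<close> to \<open>k (Y\<^sup>k\<^sup>-\<^sup>1 - Y\<^sup>k\<^sup>+\<^sup>1)\<close>. Together with the factor \<open>n Y\<close> it thus
  counts \<open>k\<close> ways down and \<open>n - k\<close> ways up.
\<close>

definition stat_step :: "nat \<Rightarrow> rat poly \<Rightarrow> rat poly" where
  "stat_step n p = (of_nat (Suc n) + of_nat n * Y) * p + (1 - Y\<^sup>2) * pderiv p"

primrec stat_poly :: "nat \<Rightarrow> rat poly" where
  "stat_poly 0 = 1"
| "stat_poly (Suc n) = stat_step n (stat_poly n)"

lemma stat_step_of_nat: "stat_step n (of_nat k * p) = of_nat k * stat_step n p"
  by (simp add: stat_step_def pderiv_mult algebra_simps)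

lemma stat_step_sum: "stat_step n (sum f A) = (\<Sum>a\<in>A. stat_step n (f a))"
  by (induction A rule: infinite_finite_induct)
    (simp_all add: stat_step_def pderiv_add algebra_simps)

text \<open>
  Summation by parts for a triangle of numbers in which row \<open>n + 1\<close> is obtained from row \<open>n\<close>: it
  moves the recurrence from the coefficients to the weights \<open>h\<close>, so that inductions over the
  rows reduce to identities between single terms.
\<close>

lemma sum_triangle_Suc:
  fixes h :: "nat \<Rightarrow> 'a::comm_semiring_1"
  assumes "c (Suc n) = 0"
  shows "(\<Sum>a\<le>Suc n. of_nat (p a * c a + (case a of 0 \<Rightarrow> 0 | Suc b \<Rightarrow> q b * c b)) * h a)
       = (\<Sum>a\<le>n. of_nat (c a) * (of_nat (p a) * h a + of_nat (q a) * h (Suc a)))"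
proof -
  have "(\<Sum>a\<le>Suc n. of_nat (p a * c a + (case a of 0 \<Rightarrow> 0 | Suc b \<Rightarrow> q b * c b)) * h a)
      = (\<Sum>a\<le>Suc n. of_nat (p a * c a) * h a)
        + (\<Sum>a\<le>Suc n. of_nat (case a of 0 \<Rightarrow> 0 | Suc b \<Rightarrow> q b * c b) * h a)"
    by (simp add: sum.distrib distrib_right del: sum.atMost_Suc)
  also have "(\<Sum>a\<le>Suc n. of_nat (p a * c a) * h a) = (\<Sum>a\<le>n. of_nat (p a * c a) * h a)"
    using assms by simp
  also have "(\<Sum>a\<le>Suc n. of_nat (case a of 0 \<Rightarrow> 0 | Suc b \<Rightarrow> q b * c b) * h a)
           = (\<Sum>a\<le>n. of_nat (q a * c a) * h (Suc a))"
    by (subst sum.atMost_Suc_shift) simp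
  finally show ?thesis
    by (simp add: sum.distrib algebra_simps)
qed

text \<open>
  The coefficient of \<open>(1 + y)\<^sup>a (1 - y)\<^sup>n\<^sup>-\<^sup>a F\<^sup>2\<^sup>a\<^sup>+\<^sup>1\<close> in \<open>2\<^sup>n\<close> times the \<open>n\<close>th derivative of the
  closed form \<open>F\<close>; the factor \<open>2\<^sup>n\<close> keeps it integral.
\<close>

fun ode_coeff :: "nat \<Rightarrow> nat \<Rightarrow> nat" where
  "ode_coeff 0 a = (if a = 0 then 1 else 0)"
| "ode_coeff (Suc n) a = (2 * a + 1) * ode_coeff n a
     + (case a of 0 \<Rightarrow> 0 | Suc b \<Rightarrow> (2 * b + 1) * ode_coeff n b)"

lemma ode_coeff_eq_0: "n < a \<Longrightarrow> ode_coeff n a = 0"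
  by (induction n arbitrary: a) (auto split: nat.split)

lemma sum_ode_coeff_Suc:
  fixes h :: "nat \<Rightarrow> 'a::comm_semiring_1"
  shows "(\<Sum>a\<le>Suc n. of_nat (ode_coeff (Suc n) a) * h a)
     = (\<Sum>a\<le>n. of_nat (ode_coeff n a) * (of_nat (2 * a + 1) * (h a + h (Suc a))))"
proof -
  have "(\<Sum>a\<le>Suc n. of_nat (ode_coeff (Suc n) a) * h a)
      = (\<Sum>a\<le>n. of_nat (ode_coeff n a)
            * (of_nat (2 * a + 1) * h a + of_nat (2 * a + 1) * h (Suc a)))"
    unfolding ode_coeff.simps
    by (rule sum_triangle_Suc[where c = "ode_coeff n"]) (simp add: ode_coeff_eq_0)
  then show ?thesis
    by (simp only: distrib_left)
qed

lemma pderiv_power_of_nat: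
  "pderiv (p ^ k) = of_nat k * p ^ (k - 1) * pderiv (p :: rat poly)"
  by (simp add: pderiv_power of_nat_poly)

lemma mult_pderiv_power:
  "p * pderiv (p ^ k) = of_nat k * p ^ k * pderiv (p :: rat poly)"
  by (cases k) (simp_all add: pderiv_power_of_nat mult_ac del: of_nat_Suc power_Suc, simp add: mult_ac)

text \<open>
  The derivation \<open>(1 - Y\<^sup>2) d/dY\<close> multiplies \<open>(1 + Y)\<^sup>a (1 - Y)\<^sup>b\<close> by \<open>a (1 - Y) - b (1 + Y)\<close>, and
  \<open>2 (n + 1 + n Y) = (2 n + 1) (1 + Y) + (1 - Y)\<close>. For \<open>n = a + b\<close> the total coefficients of
  \<open>1 + Y\<close> and \<open>1 - Y\<close> are both \<open>2 a + 1\<close>.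
\<close>

lemma stat_step_mixed_power:
  assumes "a \<le> n"
  shows "2 * stat_step n ((1 + Y) ^ a * (1 - Y) ^ (n - a))
     = of_nat (2 * a + 1) * ((1 + Y) ^ a * (1 - Y) ^ (Suc n - a)
            + (1 + Y) ^ Suc a * (1 - Y) ^ (Suc n - Suc a))"
proof -
  obtain b where n: "n = a + b"
    using assms le_Suc_ex by blast
  have da: "(1 + Y) * pderiv ((1 + Y) ^ a) = of_nat a * (1 + Y) ^ a"
    by (simp add: mult_pderiv_power pderiv_add)
  have db: "(1 - Y) * pderiv ((1 - Y) ^ b) = - (of_nat b * (1 - Y) ^ b)"
    by (simp add: mult_pderiv_power pderiv_diff)
  have "(1 - Y\<^sup>2) * pderiv ((1 + Y) ^ a * (1 - Y) ^ b)
      = (1 - Y) * (1 - Y) ^ b * ((1 + Y) * pderiv ((1 + Y) ^ a))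
        + (1 + Y) * (1 + Y) ^ a * ((1 - Y) * pderiv ((1 - Y) ^ b))"
    unfolding pderiv_mult by (simp add: power2_eq_square algebra_simps)
  then show ?thesis
    unfolding da db n stat_step_def by (simp add: Suc_diff_le algebra_simps)
qed

lemma stat_poly_expansion:
  "2 ^ n * stat_poly n = (\<Sum>a\<le>n. of_nat (ode_coeff n a) * ((1 + Y) ^ a * (1 - Y) ^ (n - a)))"
proof (induction n)
  case (Suc n)
  define B where "B n a = (1 + Y) ^ a * (1 - Y) ^ (n - a)" for n a
  have "2 ^ Suc n * stat_poly (Suc n) = 2 * (of_nat (2 ^ n) * stat_step n (stat_poly n))"
    by simp
  also have "\<dots> = 2 * stat_step n (2 ^ n * stat_poly n)"
    unfolding stat_step_of_nat[symmetric] by simp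
  also have "\<dots> = (\<Sum>a\<le>n. of_nat (ode_coeff n a) * (2 * stat_step n (B n a)))"
    unfolding Suc.IH stat_step_sum stat_step_of_nat B_def by (simp add: sum_distrib_left mult_ac)
  also have "\<dots> = (\<Sum>a\<le>n. of_nat (ode_coeff n a)
                     * (of_nat (2 * a + 1) * (B (Suc n) a + B (Suc n) (Suc a))))"
    by (intro sum.cong refl) (simp only: B_def stat_step_mixed_power atMost_iff)
  also have "\<dots> = (\<Sum>a\<le>Suc n. of_nat (ode_coeff (Suc n) a) * B (Suc n) a)"
    by (rule sum_ode_coeff_Suc[symmetric])
  finally show ?case
    by (simp only: B_def)
qed simp

lemma closed_form_nth_0: "closed_form_gf $ 0 = 1"
  by (simp add: closed_form_gf_def)

lemma one_minus_gf_y_nonzero: "1 - gf_y \<noteq> 0"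
  using to_fract_eq_iff[of Y 1] by (simp add: gf_y_eq) (simp add: Y_def one_pCons)

text \<open>
  For the quotient \<open>G = (1 - y) / D\<close> under the root, \<open>D' = - (1 - y) (D + 1 + y)\<close> yields the
  Riccati equation \<open>G' = (1 - y) G + (1 + y) G\<^sup>2\<close>, which becomes the stated equation for the
  square root.
\<close>

lemma fps_deriv_closed_form:
  "2 * fps_deriv closed_form_gf
     = fps_const (1 - gf_y) * closed_form_gf + fps_const (1 + gf_y) * closed_form_gf ^ 3"
proof -
  define y where "y = fps_const gf_y"
  define D where "D = 2 * fps_exp (gf_y - 1) - 1 - fps_const gf_y"
  define G where "G = fps_const (1 - gf_y) / D"
  define F where "F = closed_form_gf"
  have y: "fps_const (1 - gf_y) = 1 - y" "fps_const (1 + gf_y) = 1 + y"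
    by (simp_all add: y_def flip: fps_const_1_eq_1 fps_const_add fps_const_sub)
  have D0: "D $ 0 = 1 - gf_y"
    by (simp add: D_def)
  then have D0': "D $ 0 \<noteq> 0" and "D \<noteq> 0"
    using one_minus_gf_y_nonzero by auto
  have G_inverse: "G = fps_const (1 - gf_y) * inverse D"
    unfolding G_def using D0' by (simp add: fps_divide_unit)
  have GD: "G * D = 1 - y"
    unfolding G_inverse y using inverse_mult_eq_1[OF D0'] by (simp add: mult.assoc)
  have G0: "G $ 0 = 1"
    using D0 one_minus_gf_y_nonzero by (simp add: G_inverse)
  have F2: "F ^ 2 = G"
    using power_radical[of G "\<lambda>_ _. 1" 1] G0
    by (simp add: F_def closed_form_gf_def G_def D_def numeral_2_eq_2)
  have "F \<noteq> 0"
    using closed_form_nth_0 by (auto simp: F_def)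
  \<comment> \<open>The exponential is eliminated by \<open>2 exp (x (y - 1)) = D + 1 + y\<close>.\<close>
  have D': "fps_deriv D = - (1 - y) * (D + 1 + y)"
    by (simp add: D_def y_def algebra_simps flip: fps_const_sub)
  have "fps_deriv (G * D) = 0"
    unfolding GD by (simp add: y_def)
  then have "D * fps_deriv G = (1 - y) * G * (D + 1 + y)"
    by (simp add: D' algebra_simps)
  also have "\<dots> = D * ((1 - y) * G + (1 + y) * G\<^sup>2)"
    unfolding power2_eq_square by (simp add: algebra_simps flip: GD)
  finally have G': "fps_deriv G = (1 - y) * G + (1 + y) * G\<^sup>2"
    using \<open>D \<noteq> 0\<close> by simp
  have "F * (2 * fps_deriv F) = fps_deriv G"
    by (simp add: algebra_simps power2_eq_square flip: F2)
  also have "\<dots> = F * ((1 - y) * F + (1 + y) * F ^ 3)"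
    unfolding G' by (simp add: algebra_simps eval_nat_numeral flip: F2)
  finally show ?thesis
    using \<open>F \<noteq> 0\<close> unfolding F_def y by simp
qed

text \<open>
  Differentiating \<open>F\<^sup>2\<^sup>a\<^sup>+\<^sup>1\<close> with the differential equation produces only \<open>F\<^sup>2\<^sup>a\<^sup>+\<^sup>1\<close> and
  \<open>F\<^sup>2\<^sup>a\<^sup>+\<^sup>3\<close>, both with coefficient \<open>2 a + 1\<close>, just as in \<open>stat_step_mixed_power\<close>.
\<close>

lemma fps_nth_deriv_closed_form:
  "2 ^ n * fps_nth_deriv n closed_form_gf
     = (\<Sum>a\<le>n. of_nat (ode_coeff n a)
          * (fps_const ((1 + gf_y) ^ a * (1 - gf_y) ^ (n - a)) * closed_form_gf ^ (2 * a + 1)))"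
proof (induction n)
  case (Suc n)
  define F where "F = closed_form_gf"
  define K where "K n a = fps_const ((1 + gf_y) ^ a * (1 - gf_y) ^ (n - a))" for n a
  have step: "2 * fps_deriv (K n a * F ^ (2 * a + 1))
      = of_nat (2 * a + 1) * (K (Suc n) a * F ^ (2 * a + 1)
                              + K (Suc n) (Suc a) * F ^ (2 * Suc a + 1))"
    if "a \<le> n" for a
  proof -
    have "2 * fps_deriv (K n a * F ^ (2 * a + 1))
        = K n a * of_nat (2 * a + 1) * F ^ (2 * a) * (2 * fps_deriv F)"
      unfolding K_def by (subst fps_deriv_mult, subst fps_deriv_power)
        (simp add: fps_of_nat[symmetric] del: fps_const_mult power_Suc of_nat_Suc)
    also have "\<dots> = of_nat (2 * a + 1) * (K n a * fps_const (1 - gf_y) * F ^ (2 * a + 1)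
                              + K n a * fps_const (1 + gf_y) * F ^ (2 * Suc a + 1))"
      unfolding F_def fps_deriv_closed_form by (simp add: algebra_simps eval_nat_numeral)
    also have "K n a * fps_const (1 - gf_y) = K (Suc n) a"
      using that by (simp add: K_def Suc_diff_le mult_ac)
    also have "K n a * fps_const (1 + gf_y) = K (Suc n) (Suc a)"
      by (simp add: K_def mult_ac)
    finally show ?thesis .
  qed
  have "2 ^ Suc n * fps_nth_deriv (Suc n) F = 2 * fps_deriv (2 ^ n * fps_nth_deriv n F)"
    by (simp add: fps_nth_deriv_commute fps_deriv_power del: fps_nth_deriv.simps)
  also have "\<dots> = (\<Sum>a\<le>n. of_nat (ode_coeff n a) * (2 * fps_deriv (K n a * F ^ (2 * a + 1))))"
    unfolding Suc.IH[folded F_def]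
    by (simp add: fps_deriv_sum sum_distrib_left K_def algebra_simps)
  also have "\<dots> = (\<Sum>a\<le>n. of_nat (ode_coeff n a) * (of_nat (2 * a + 1)
        * (K (Suc n) a * F ^ (2 * a + 1) + K (Suc n) (Suc a) * F ^ (2 * Suc a + 1))))"
    using step by (intro sum.cong) simp_all
  also have "\<dots> = (\<Sum>a\<le>Suc n. of_nat (ode_coeff (Suc n) a) * (K (Suc n) a * F ^ (2 * a + 1)))"
    by (rule sum_ode_coeff_Suc[symmetric])
  finally show ?case
    by (simp only: F_def K_def)
qed simp

lemma closed_form_nth: "closed_form_gf $ n = to_fract (stat_poly n) / fact n"
proof -
  have "2 ^ n * (fact n * closed_form_gf $ n)
      = (2 ^ n * fps_nth_deriv n closed_form_gf) $ 0"
    by (simp add: fps_deriv_maclauren_0 fps_power_zeroth)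
  also have "\<dots> = to_fract (2 ^ n * stat_poly n)"
    unfolding fps_nth_deriv_closed_form stat_poly_expansion
    by (simp add: fps_sum_nth closed_form_nth_0 fps_power_zeroth gf_y_eq to_fract_power to_fract_of_nat)
  also have "\<dots> = 2 ^ n * to_fract (stat_poly n)"
    using to_fract_of_nat[of 2, where 'a = "rat poly"] by (simp add: to_fract_power)
  finally show ?thesis
    by (simp add: field_simps)
qed

section \<open>Statistics counted by the polynomials\<close>

text \<open>
  Finiteness has to be demanded, since the sum over an infinite set is \<open>0\<close>.
\<close>

definition counted_by_stat_poly :: "(nat \<Rightarrow> 'a set) \<Rightarrow> ('a \<Rightarrow> nat) \<Rightarrow> bool" where
  "counted_by_stat_poly A f \<longleftrightarrow>
     (\<forall>n. finite (A n) \<and> (\<Sum>a\<in>A n. Y ^ f a) = stat_poly n)"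

lemma card_eq_coeff_stat_poly:
  assumes "counted_by_stat_poly A f"
  shows "of_nat (card {a \<in> A n. f a = k}) = coeff (stat_poly n) k"
proof -
  have "coeff (stat_poly n) k = (\<Sum>a\<in>A n. coeff (Y ^ f a) k)"
    using assms unfolding counted_by_stat_poly_def by (metis coeff_sum)
  also have "\<dots> = (\<Sum>a\<in>A n. if f a = k then 1 else 0)"
    by (intro sum.cong) (auto simp: coeff_Y_power)
  also have "\<dots> = of_nat (card {a \<in> A n. f a = k})"
    using assms by (simp add: counted_by_stat_poly_def sum.If_cases Int_def)
  finally show ?thesis ..
qed

lemma equidistributed_if_counted_by_stat_poly:
  assumes "counted_by_stat_poly A f" and "counted_by_stat_poly B g"
  shows "equidistributed A f B g"
  unfolding equidistributed_def
  using card_eq_coeff_stat_poly[OF assms(1)] card_eq_coeff_stat_poly[OF assms(2)]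
  by (metis of_nat_eq_iff)

lemma stat_gf_eq_closed_form_gf:
  assumes "counted_by_stat_poly A f"
  shows "stat_gf A f = closed_form_gf"
proof (rule fps_ext)
  fix n
  have "(\<Sum>a\<in>A n. gf_y ^ f a) = to_fract (\<Sum>a\<in>A n. Y ^ f a)"
    by (simp add: gf_y_eq to_fract_power)
  also have "\<dots> = to_fract (stat_poly n)"
    using assms by (simp add: counted_by_stat_poly_def)
  finally show "stat_gf A f $ n = closed_form_gf $ n"
    by (simp add: stat_gf_def closed_form_nth)
qed

lemma sum_over_extensions:
  assumes "bij_betw (\<lambda>(a, s). ext a s) (A \<times> S) B"
  shows "(\<Sum>b\<in>B. h b) = (\<Sum>a\<in>A. \<Sum>s\<in>S. h (ext a s))"
  using sum.reindex_bij_betw[OF assms, of h]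
  by (simp add: sum.cartesian_product case_prod_unfold)

lemma stat_step_monomial:
  assumes "k \<le> n"
  shows "stat_step n (Y ^ k)
    = of_nat (Suc n) * Y ^ k + of_nat (n - k) * Y ^ Suc k + of_nat k * Y ^ (k - 1)"
proof -
  have square: "Y\<^sup>2 * (of_nat k * Y ^ (k - 1)) = of_nat k * Y ^ Suc k"
    by (cases k) (simp_all add: power2_eq_square)
  have "of_nat n = (of_nat (n - k) + of_nat k :: rat poly)"
    using assms by (simp flip: of_nat_add)
  then have "of_nat n * Y * Y ^ k = of_nat (n - k) * Y ^ Suc k + of_nat k * Y ^ Suc k"
    by (simp add: algebra_simps)
  moreover have "(1 - Y\<^sup>2) * pderiv (Y ^ k) = of_nat k * Y ^ (k - 1) - of_nat k * Y ^ Suc k"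
    unfolding square[symmetric] by (simp add: pderiv_power_of_nat left_diff_distrib)
  ultimately show ?thesis
    by (simp add: stat_step_def distrib_right)
qed

text \<open>
  The objects of size \<open>n + 1\<close> arise uniquely from an object \<open>a\<close> of size \<open>n\<close> and one of \<open>2 n + 1\<close>
  slots; filling a slot in \<open>up n a\<close> raises the statistic and one in \<open>down n a\<close> lowers it.
  The cardinalities are those of the expansion in \<open>stat_step_monomial\<close>.
\<close>

lemma counted_by_stat_poly_if_balanced_growth:
  assumes base: "A 0 = {a0}" "f a0 = 0"
    and finite_slots: "\<And>n. finite (S n)"
    and card_slots: "\<And>n. card (S n) = 2 * n + 1"
    and growth: "\<And>n. bij_betw (\<lambda>(a, s). ext n a s) (A n \<times> S n) (A (Suc n))"
    and bound: "\<And>n a. a \<in> A n \<Longrightarrow> f a \<le> n"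
    and subsets: "\<And>n a. a \<in> A n \<Longrightarrow> up n a \<subseteq> S n" "\<And>n a. a \<in> A n \<Longrightarrow> down n a \<subseteq> S n"
    and disjoint: "\<And>n a. a \<in> A n \<Longrightarrow> up n a \<inter> down n a = {}"
    and card_up: "\<And>n a. a \<in> A n \<Longrightarrow> card (up n a) = n - f a"
    and card_down: "\<And>n a. a \<in> A n \<Longrightarrow> card (down n a) = f a"
    and stat: "\<And>n a s. a \<in> A n \<Longrightarrow> s \<in> S n \<Longrightarrow> f (ext n a s)
       = (if s \<in> up n a then Suc (f a) else if s \<in> down n a then f a - 1 else f a)"
  shows "counted_by_stat_poly A f"
proof -
  have "finite (A n) \<and> (\<Sum>a\<in>A n. Y ^ f a) = stat_poly n" for n
  proof (induction n)
    case (Suc n)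
    then have fin: "finite (A n)" and IH: "(\<Sum>a\<in>A n. Y ^ f a) = stat_poly n"
      by auto
    have slots: "(\<Sum>s\<in>S n. Y ^ f (ext n a s))
        = of_nat (Suc n) * Y ^ f a + of_nat (n - f a) * Y ^ Suc (f a) + of_nat (f a) * Y ^ (f a - 1)"
      if a: "a \<in> A n" for a
    proof -
      let ?U = "up n a" and ?D = "down n a"
      have finUD: "finite ?U" "finite ?D"
        using finite_slots subsets[OF a] finite_subset by blast+
      have S: "S n = (S n - (?U \<union> ?D)) \<union> (?U \<union> ?D)"
        using subsets[OF a] by blast
      have "card (S n - (?U \<union> ?D)) = 2 * n + 1 - (n - f a + f a)"
        using subsets[OF a] finUD
        by (simp add: card_Diff_subset card_Un_disjoint disjoint a card_slots card_up card_down)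
      also have "\<dots> = Suc n"
        using bound[OF a] by simp
      finally have rest: "card (S n - (?U \<union> ?D)) = Suc n" .
      have "(\<Sum>s\<in>S n. Y ^ f (ext n a s))
          = (\<Sum>s\<in>S n - (?U \<union> ?D). Y ^ f (ext n a s))
            + ((\<Sum>s\<in>?U. Y ^ f (ext n a s)) + (\<Sum>s\<in>?D. Y ^ f (ext n a s)))"
        by (subst S, subst sum.union_disjoint)
          (use finUD finite_slots in \<open>auto simp: sum.union_disjoint disjoint a\<close>)
      also have "(\<Sum>s\<in>S n - (?U \<union> ?D). Y ^ f (ext n a s)) = of_nat (Suc n) * Y ^ f a"
        using stat[OF a] rest by simp
      also have "(\<Sum>s\<in>?U. Y ^ f (ext n a s)) = (\<Sum>s\<in>?U. Y ^ Suc (f a))"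
        using stat[OF a] subsets[OF a] by (intro sum.cong) auto
      also have "(\<Sum>s\<in>?D. Y ^ f (ext n a s)) = (\<Sum>s\<in>?D. Y ^ (f a - 1))"
      proof (intro sum.cong refl)
        fix s assume "s \<in> ?D"
        moreover from this have "s \<in> S n" "s \<notin> ?U"
          using subsets[OF a] disjoint[OF a] by auto
        ultimately show "Y ^ f (ext n a s) = Y ^ (f a - 1)"
          by (simp add: stat[OF a])
      qed
      finally show ?thesis
        by (simp add: card_up card_down a)
    qed
    have "finite (A (Suc n))"
      using bij_betw_finite[OF growth[of n]] fin finite_slots by simp
    moreover have "(\<Sum>b\<in>A (Suc n). Y ^ f b) = stat_poly (Suc n)"
      using slots bound
      by (simp add: sum_over_extensions[OF growth] stat_step_sum stat_step_monomial flip: IH)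
    ultimately show ?case ..
  qed (simp add: base)
  then show ?thesis
    by (simp add: counted_by_stat_poly_def)
qed

lemma counted_by_stat_poly_bij:
  assumes "counted_by_stat_poly A f" and "\<And>n. bij_betw (\<phi> n) (A n) (B n)"
    and "\<And>n a. a \<in> A n \<Longrightarrow> g (\<phi> n a) = f a"
  shows "counted_by_stat_poly B g"
  unfolding counted_by_stat_poly_def
proof (intro allI conjI)
  fix n
  show "finite (B n)"
    using assms(1) bij_betw_finite[OF assms(2)[of n]] by (simp add: counted_by_stat_poly_def)
  have "(\<Sum>b\<in>B n. Y ^ g b) = (\<Sum>a\<in>A n. Y ^ g (\<phi> n a))"
    by (rule sum.reindex_bij_betw[OF assms(2), symmetric])
  also have "\<dots> = (\<Sum>a\<in>A n. Y ^ f a)"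
    using assms(3) by (intro sum.cong) simp_all
  also have "\<dots> = stat_poly n"
    using assms(1) by (simp add: counted_by_stat_poly_def)
  finally show "(\<Sum>b\<in>B n. Y ^ g b) = stat_poly n" .
qed

section \<open>Trapezoidal words\<close>

lemma trapezoidal_words_0: "trapezoidal_words 0 = {[]}"
  by (auto simp: trapezoidal_words_def)

lemma bij_betw_append_letter:
  "bij_betw (\<lambda>(w, x). w @ [x]) (trapezoidal_words n \<times> {1..2 * n + 1}) (trapezoidal_words (Suc n))"
proof (rule bij_betw_byWitness[where f' = "\<lambda>w. (butlast w, last w)"])
  show "(\<lambda>(w, x). w @ [x]) ` (trapezoidal_words n \<times> {1..2 * n + 1}) \<subseteq> trapezoidal_words (Suc n)"
    by (auto simp: trapezoidal_words_def nth_append less_Suc_eq)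
  show "(\<lambda>w. (butlast w, last w)) ` trapezoidal_words (Suc n) \<subseteq> trapezoidal_words n \<times> {1..2 * n + 1}"
    by (auto simp: trapezoidal_words_def nth_butlast last_conv_nth simp flip: length_greater_0_conv)
qed (auto simp: trapezoidal_words_def simp flip: length_greater_0_conv)

definition odd_evens :: "nat list \<Rightarrow> nat set" where
  "odd_evens w = {a. even a \<and> odd (count_list w a)}"

lemma num_even_odd_times_eq: "num_even_odd_times w = card (odd_evens w)"
proof -
  have "{a \<in> set w. even a \<and> odd (count_list w a)} = odd_evens w"
    by (auto simp: odd_evens_def) (metis count_notin even_zero)
  then show ?thesis
    by (simp add: num_even_odd_times_def)
qed

lemma odd_evens_append_letter:
  "odd_evens (w @ [x]) = (if odd x then odd_evens w
     else if x \<in> odd_evens w then odd_evens w - {x} else insert x (odd_evens w))"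
  by (auto simp: odd_evens_def split: if_splits)

definition evens :: "nat \<Rightarrow> nat set" where
  "evens n = {a \<in> {1..2 * n}. even a}"

lemma card_evens: "card (evens n) = n"
proof -
  have "evens n = (*) 2 ` {1..n}"
    by (auto simp: evens_def elim!: evenE)
  then show ?thesis
    by (simp add: card_image inj_on_def)
qed

lemma finite_evens [simp]: "finite (evens n)"
  by (simp add: evens_def)

lemma odd_evens_subset:
  assumes "w \<in> trapezoidal_words n"
  shows "odd_evens w \<subseteq> evens n"
proof
  fix a assume a: "a \<in> odd_evens w"
  then have "a \<in> set w"
    by (metis (mono_tags, lifting) count_notin even_zero mem_Collect_eq odd_evens_def)
  then obtain k where "k < n" "a = w ! k"
    using assms by (auto simp: trapezoidal_words_def in_set_conv_nth)
  then have "1 \<le> a" "a \<le> 2 * k + 1"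
    using assms by (auto simp: trapezoidal_words_def)
  then show "a \<in> evens n"
    using a \<open>k < n\<close> by (auto simp: odd_evens_def evens_def)
qed

text \<open>
  The letters available in position \<open>n + 1\<close> are \<open>n + 1\<close> odd ones, which do not matter, and \<open>n\<close>
  even ones, each of which leaves or enters the set of even letters of odd multiplicity.
\<close>

lemma counted_by_stat_poly_words:
  "counted_by_stat_poly trapezoidal_words num_even_odd_times"
proof (rule counted_by_stat_poly_if_balanced_growth[where S = "\<lambda>n. {1..2 * n + 1}"
      and ext = "\<lambda>n w x. w @ [x]" and down = "\<lambda>n w. odd_evens w"
      and up = "\<lambda>n w. evens n - odd_evens w"])
  fix n w assume w: "w \<in> trapezoidal_words n"
  note sub = odd_evens_subset[OF w]
  have fin: "finite (odd_evens w)"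
    using sub by (rule finite_subset) simp
  show "num_even_odd_times w \<le> n"
    unfolding num_even_odd_times_eq using card_mono[OF _ sub] by (simp add: card_evens)
  show "card (evens n - odd_evens w) = n - num_even_odd_times w"
    unfolding num_even_odd_times_eq using sub fin by (simp add: card_Diff_subset card_evens)
  show "num_even_odd_times (w @ [x])
      = (if x \<in> evens n - odd_evens w then Suc (num_even_odd_times w)
         else if x \<in> odd_evens w then num_even_odd_times w - 1 else num_even_odd_times w)"
    if "x \<in> {1..2 * n + 1}" for x
    unfolding num_even_odd_times_eq odd_evens_append_letter
    using that fin sub by (auto simp: evens_def card_Diff_singleton card_insert_if)
  show "odd_evens w \<subseteq> {1..2 * n + 1}"
    using sub by (auto simp: evens_def)
qed (use bij_betw_append_letter trapezoidal_words_0 in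
      \<open>auto simp: evens_def num_even_odd_times_eq odd_evens_def\<close>)

section \<open>Perfect matchings\<close>

text \<open>
  A matching of \<open>I\<close> is encoded by the function that sends each point to its partner. It is the
  identity outside \<open>I\<close>, which makes the encoding unique.
\<close>

definition matching_involutions :: "nat set \<Rightarrow> (nat \<Rightarrow> nat) set" where
  "matching_involutions I =
     {f. (\<forall>i\<in>I. f i \<in> I \<and> f i \<noteq> i \<and> f (f i) = i) \<and> (\<forall>i. i \<notin> I \<longrightarrow> f i = i)}"

lemma bij_betw_involution_matching:
  "bij_betw (\<lambda>f. (\<lambda>i. {i, f i}) ` I) (matching_involutions I)
     {M. partition_on I M \<and> (\<forall>e\<in>M. card e = 2)}"
proof (rule bij_betw_imageI)
  show "inj_on (\<lambda>f. (\<lambda>i. {i, f i}) ` I) (matching_involutions I)"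
  proof (rule inj_onI, rule ext)
    fix f g i
    assume f: "f \<in> matching_involutions I" and g: "g \<in> matching_involutions I"
      and eq: "(\<lambda>i. {i, f i}) ` I = (\<lambda>i. {i, g i}) ` I"
    show "f i = g i"
    proof (cases "i \<in> I")
      case True
      then obtain j where "j \<in> I" "{i, f i} = {j, g j}"
        using eq by blast
      then show ?thesis
        using g by (auto simp: matching_involutions_def doubleton_eq_iff)
    qed (use f g in \<open>auto simp: matching_involutions_def\<close>)
  qed
  show "(\<lambda>f. (\<lambda>i. {i, f i}) ` I) ` matching_involutions I
      = {M. partition_on I M \<and> (\<forall>e\<in>M. card e = 2)}"
  proof (intro equalityI subsetI)
    fix M assume "M \<in> (\<lambda>f. (\<lambda>i. {i, f i}) ` I) ` matching_involutions I"
    then obtain f where f: "f \<in> matching_involutions I" and M: "M = (\<lambda>i. {i, f i}) ` I"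
      by blast
    have "partition_on I M"
    proof (rule partition_onI)
      fix p q assume pq: "p \<in> M" "q \<in> M" "p \<noteq> q"
      then obtain i j where "i \<in> I" "j \<in> I" "p = {i, f i}" "q = {j, f j}"
        unfolding M by blast
      moreover from this have "f (f i) = i" "f (f j) = j"
        using f by (auto simp: matching_involutions_def)
      ultimately show "disjnt p q"
        using pq(3) by (auto simp: disjnt_def)
    qed (use f in \<open>auto simp: M matching_involutions_def\<close>)
    moreover have "\<forall>e\<in>M. card e = 2"
      using f by (auto simp: M matching_involutions_def card_insert_if)
    ultimately show "M \<in> {M. partition_on I M \<and> (\<forall>e\<in>M. card e = 2)}"
      by simp
  next
    fix M assume "M \<in> {M. partition_on I M \<and> (\<forall>e\<in>M. card e = 2)}"
    then have part: "partition_on I M" and two: "\<And>e. e \<in> M \<Longrightarrow> card e = 2"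
      by auto
    have edge_unique: "e = e'" if "e \<in> M" "e' \<in> M" "i \<in> e" "i \<in> e'" for e e' i
      using partition_onD2[OF part] that by (auto simp: disjoint_def)
    have "\<exists>j. {i, j} \<in> M \<and> j \<noteq> i" if "i \<in> I" for i
    proof -
      obtain e where "e \<in> M" "i \<in> e"
        using partition_onD1[OF part] \<open>i \<in> I\<close> by blast
      moreover from this obtain j where "e = {i, j}" "j \<noteq> i"
        using two[of e] by (auto simp: card_2_iff)
      ultimately show ?thesis
        by blast
    qed
    then obtain p where p: "\<And>i. i \<in> I \<Longrightarrow> {i, p i} \<in> M \<and> p i \<noteq> i"
      by metis
    define f where "f i = (if i \<in> I then p i else i)" for i
    have in_I: "p i \<in> I" if "i \<in> I" for i
      using partition_onD1[OF part] p[OF that] by blast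
    have "p (p i) = i" if "i \<in> I" for i
      using edge_unique[of "{p i, p (p i)}" "{i, p i}" "p i"] p[OF that] p[OF in_I[OF that]]
      by (auto simp: doubleton_eq_iff)
    then have "f \<in> matching_involutions I"
      using p in_I by (auto simp: matching_involutions_def f_def)
    moreover have "M = (\<lambda>i. {i, f i}) ` I"
    proof (intro equalityI subsetI)
      fix e assume e: "e \<in> M"
      then obtain i where i: "i \<in> e"
        using two[OF e] by (auto simp: card_2_iff)
      then have "i \<in> I"
        using partition_onD1[OF part] e by blast
      then show "e \<in> (\<lambda>i. {i, f i}) ` I"
        using edge_unique[OF e _ i, of "{i, p i}"] p[of i] by (auto simp: f_def)
    qed (auto simp: f_def p)
    ultimately show "M \<in> (\<lambda>f. (\<lambda>i. {i, f i}) ` I) ` matching_involutions I"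
      by blast
  qed
qed

definition up_evens :: "(nat \<Rightarrow> nat) \<Rightarrow> nat set" where
  "up_evens f = {i. even i \<and> odd (f i) \<and> i < f i}"

lemma up_evens_subset:
  assumes "f \<in> matching_involutions {1..2 * n}"
  shows "up_evens f \<subseteq> evens n"
proof
  fix i assume i: "i \<in> up_evens f"
  then have "i \<in> {1..2 * n}"
    using assms unfolding matching_involutions_def up_evens_def
    by (metis (mono_tags, lifting) less_irrefl mem_Collect_eq)
  then show "i \<in> evens n"
    using i by (simp add: evens_def up_evens_def)
qed

text \<open>
  Dots are even or odd points, and \<open>i < j\<close> is equivalent to \<open>2 i < 2 j - 1\<close>.
\<close>

lemma upline_iff:
  "(\<exists>i j. 1 \<le> i \<and> i < j \<and> e = {bottom_dot i, top_dot j})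
     \<longleftrightarrow> (\<exists>a b. 1 \<le> a \<and> even a \<and> odd b \<and> a < b \<and> e = {a, b})"
proof
  assume "\<exists>a b. 1 \<le> a \<and> even a \<and> odd b \<and> a < b \<and> e = {a, b}"
  then obtain a b where ab: "1 \<le> a" "even a" "odd b" "a < b" "e = {a, b}"
    by blast
  moreover obtain i where "a = 2 * i"
    using ab(2) by (elim evenE)
  moreover obtain j where "b = 2 * j + 1"
    using ab(3) by (elim oddE)
  ultimately show "\<exists>i j. 1 \<le> i \<and> i < j \<and> e = {bottom_dot i, top_dot j}"
    by (intro exI[of _ i] exI[of _ "Suc j"]) (auto simp: bottom_dot_def top_dot_def)
next
  assume "\<exists>i j. 1 \<le> i \<and> i < j \<and> e = {bottom_dot i, top_dot j}"
  then obtain i j where "1 \<le> i" "i < j" "e = {bottom_dot i, top_dot j}"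
    by blast
  then show "\<exists>a b. 1 \<le> a \<and> even a \<and> odd b \<and> a < b \<and> e = {a, b}"
    by (intro exI[of _ "2 * i"] exI[of _ "2 * j - 1"]) (auto simp: bottom_dot_def top_dot_def)
qed

lemma num_uplines_involution:
  assumes "f \<in> matching_involutions {1..2 * n}"
  shows "num_uplines ((\<lambda>i. {i, f i}) ` {1..2 * n}) = card (up_evens f)"
proof -
  have "{e \<in> (\<lambda>i. {i, f i}) ` {1..2 * n}. \<exists>a b. 1 \<le> a \<and> even a \<and> odd b \<and> a < b \<and> e = {a, b}}
      = (\<lambda>i. {i, f i}) ` up_evens f"
  proof (intro equalityI subsetI)
    fix e
    assume "e \<in> {e \<in> (\<lambda>i. {i, f i}) ` {1..2 * n}.
                  \<exists>a b. 1 \<le> a \<and> even a \<and> odd b \<and> a < b \<and> e = {a, b}}"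
    then obtain i a b where i: "i \<in> {1..2 * n}" "e = {i, f i}"
      and ab: "even a" "odd b" "a < b" "e = {a, b}"
      by blast
    have "f a = b"
      using i ab(4) assms by (auto simp: matching_involutions_def doubleton_eq_iff)
    then show "e \<in> (\<lambda>i. {i, f i}) ` up_evens f"
      using ab by (intro image_eqI[of _ _ a]) (simp_all add: up_evens_def)
  next
    fix e assume "e \<in> (\<lambda>i. {i, f i}) ` up_evens f"
    then obtain i where i: "i \<in> up_evens f" "e = {i, f i}"
      by blast
    moreover from this have "i \<in> {1..2 * n}"
      using up_evens_subset[OF assms] by (auto simp: evens_def)
    moreover from i this have "1 \<le> i \<and> even i \<and> odd (f i) \<and> i < f i \<and> e = {i, f i}"
      by (simp add: up_evens_def)
    ultimately show "e \<in> {e \<in> (\<lambda>i. {i, f i}) ` {1..2 * n}.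
                  \<exists>a b. 1 \<le> a \<and> even a \<and> odd b \<and> a < b \<and> e = {a, b}}"
      by blast
  qed
  moreover have "inj_on (\<lambda>i. {i, f i}) (up_evens f)"
    by (auto simp: inj_on_def up_evens_def doubleton_eq_iff)
  ultimately show ?thesis
    by (simp only: num_uplines_def upline_iff card_image)
qed

definition conj_transpose :: "nat \<Rightarrow> nat \<Rightarrow> (nat \<Rightarrow> nat) \<Rightarrow> nat \<Rightarrow> nat" where
  "conj_transpose a b f = transpose a b \<circ> f \<circ> transpose a b"

lemma conj_transpose_twice [simp]: "conj_transpose a b (conj_transpose a b f) = f"
  by (simp add: conj_transpose_def fun_eq_iff)

lemma conj_transpose_mem:
  assumes "f \<in> matching_involutions J" "a \<in> J" "b \<in> J"
  shows "conj_transpose a b f \<in> matching_involutions J"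
proof -
  have J: "transpose a b i \<in> J \<longleftrightarrow> i \<in> J" for i
    using assms(2,3) by (auto simp: transpose_def)
  have neq: "transpose a b (f (transpose a b i)) \<noteq> i" if "i \<in> J" for i
  proof
    assume "transpose a b (f (transpose a b i)) = i"
    then have "f (transpose a b i) = transpose a b i"
      by (metis transpose_involutory)
    then show False
      using assms(1) that J[of i] by (auto simp: matching_involutions_def)
  qed
  show ?thesis
    using assms(1) J neq by (simp add: matching_involutions_def conj_transpose_def)
qed

lemma fun_upd_pair_mem:
  assumes "x \<notin> I" "y \<notin> I" "x \<noteq> y" "f \<in> matching_involutions I"
  shows "f(x := y, y := x) \<in> matching_involutions (insert x (insert y I))"
  using assms by (auto simp: matching_involutions_def)

lemma fun_upd_remove_pair_mem:
  assumes "x \<notin> I" "y \<notin> I" "f \<in> matching_involutions (insert x (insert y I))" "f x = y"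
  shows "f(x := x, y := y) \<in> matching_involutions I"
proof -
  have f: "f i \<in> insert x (insert y I) \<and> f i \<noteq> i \<and> f (f i) = i" if "i \<in> insert x (insert y I)" for i
    using assms(3) that unfolding matching_involutions_def by blast
  have "f y = x"
    using f[of x] assms(4) by simp
  have "f i \<in> I" if "i \<in> I" for i
    using f[of i] that assms(1,2,4) \<open>f y = x\<close> by (metis insert_iff)
  moreover have "i \<noteq> x" "i \<noteq> y" if "i \<in> I" for i
    using that assms(1,2) by auto
  moreover have "f i = i" if "i \<notin> I" "i \<noteq> x" "i \<noteq> y" for i
    using that assms(3) unfolding matching_involutions_def by blast
  ultimately show ?thesis
    using f unfolding matching_involutions_def by simp
qed

text \<open>
  First \<open>x\<close> and \<open>y\<close> are matched with each other; then \<open>y\<close> and \<open>a\<close> change places. As a result \<open>x\<close> is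
  matched with \<open>a\<close>, and \<open>y\<close> with the former partner of \<open>a\<close>. The slot \<open>a = y\<close> keeps \<open>x\<close> and \<open>y\<close>
  together. Writing the exchange as a conjugation makes it visibly invertible.
\<close>

definition attach_pair :: "nat \<Rightarrow> nat \<Rightarrow> (nat \<Rightarrow> nat) \<Rightarrow> nat \<Rightarrow> nat \<Rightarrow> nat" where
  "attach_pair x y f a = conj_transpose y a (f(x := y, y := x))"

lemma bij_betw_attach_pair:
  assumes "x \<notin> I" "y \<notin> I" "x \<noteq> y"
  shows "bij_betw (\<lambda>(f, a). attach_pair x y f a) (matching_involutions I \<times> insert y I)
    (matching_involutions (insert x (insert y I)))"
proof -
  let ?J = "insert x (insert y I)"
  \<comment> \<open>Exchanging \<open>y\<close> with the partner of \<open>x\<close> matches \<open>x\<close> with \<open>y\<close> again, so both can be removed.\<close>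
  define detach where "detach g = (conj_transpose y (g x) g)(x := x, y := y)" for g
  have attach: "attach_pair x y f a \<in> matching_involutions ?J"
      "detach (attach_pair x y f a) = f" "attach_pair x y f a x = a"
    if f: "f \<in> matching_involutions I" and a: "a \<in> insert y I" for f a
  proof -
    show "attach_pair x y f a \<in> matching_involutions ?J"
      unfolding attach_pair_def using fun_upd_pair_mem[OF assms f] a
      by (intro conj_transpose_mem) auto
    show ax: "attach_pair x y f a x = a"
      using assms a by (auto simp: attach_pair_def conj_transpose_def transpose_def)
    show "detach (attach_pair x y f a) = f"
      unfolding detach_def ax unfolding attach_pair_def conj_transpose_twice
      using f assms by (auto simp: matching_involutions_def)
  qed
  have detach: "detach g \<in> matching_involutions I" "g x \<in> insert y I"
      "attach_pair x y (detach g) (g x) = g"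
    if g: "g \<in> matching_involutions ?J" for g
  proof -
    define h where "h = conj_transpose y (g x) g"
    have gx: "g x \<in> insert y I" "g x \<noteq> x" "g (g x) = x"
      using g by (auto simp: matching_involutions_def)
    then have h: "h \<in> matching_involutions ?J"
      unfolding h_def by (intro conj_transpose_mem g) auto
    have hxy: "h x = y" "h y = x"
      using assms(3) gx by (simp_all add: h_def conj_transpose_def transpose_def)
    show "detach g \<in> matching_involutions I"
      unfolding detach_def using fun_upd_remove_pair_mem[OF assms(1,2) h hxy(1)]
      by (simp add: h_def)
    have "(h(x := x, y := y))(x := y, y := x) = h"
      using hxy by auto
    then show "attach_pair x y (detach g) (g x) = g"
      unfolding attach_pair_def detach_def h_def[symmetric] by (simp add: h_def)
    show "g x \<in> insert y I"
      by (fact gx(1))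
  qed
  show ?thesis
  proof (rule bij_betw_byWitness[where f' = "\<lambda>g. (detach g, g x)"])
    show "(\<lambda>g. (detach g, g x)) ` matching_involutions ?J \<subseteq> matching_involutions I \<times> insert y I"
      using detach(1,2) by blast
  qed (use attach detach(3) in auto)
qed

text \<open>
  For \<open>a \<noteq> 2 n + 2\<close> the odd point \<open>2 n + 1\<close> exceeds its partner \<open>a\<close>, so they form an upline if and only if \<open>a\<close> is
  even. The former partner of \<open>a\<close> is now matched with an even point larger than itself, so it is
  not the lower end of an upline any more.
\<close>

lemma up_evens_attach_pair:
  assumes f: "f \<in> matching_involutions {1..2 * n}" and a: "a \<in> insert (2 * n + 2) {1..2 * n}"
  shows "up_evens (attach_pair (2 * n + 1) (2 * n + 2) f a)
    = (if a = 2 * n + 2 then up_evens f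
       else if even a then insert a (up_evens f) else up_evens f - {f a})"
proof (cases "a = 2 * n + 2")
  case True
  have "attach_pair (2 * n + 1) (2 * n + 2) f (2 * n + 2) = f(2 * n + 1 := 2 * n + 2, 2 * n + 2 := 2 * n + 1)"
    by (simp add: attach_pair_def conj_transpose_def)
  then show ?thesis
    using f True by (auto simp: up_evens_def matching_involutions_def)
next
  case False
  then have a: "a \<in> {1..2 * n}"
    using a by simp
  have fa: "f a \<in> {1..2 * n}" "f a \<noteq> a" "f (f a) = a"
    using f a by (auto simp: matching_involutions_def)
  have out: "f (2 * n + 1) = 2 * n + 1" "f (2 * n + 2) = 2 * n + 2"
    using f by (auto simp: matching_involutions_def)
  define g where "g = attach_pair (2 * n + 1) (2 * n + 2) f a"
  have g: "g a = 2 * n + 1" "g (2 * n + 1) = a" "g (f a) = 2 * n + 2" "g (2 * n + 2) = f a"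
    "\<And>i. i \<notin> {a, 2 * n + 1, f a, 2 * n + 2} \<Longrightarrow> g i = f i"
  proof -
    show "g a = 2 * n + 1" "g (2 * n + 1) = a" "g (f a) = 2 * n + 2" "g (2 * n + 2) = f a"
      using False a fa by (auto simp: g_def attach_pair_def conj_transpose_def transpose_def)
    fix i assume i: "i \<notin> {a, 2 * n + 1, f a, 2 * n + 2}"
    have "f (f i) = i"
      using f by (cases "i \<in> {1..2 * n}") (auto simp: matching_involutions_def)
    then have "f i \<noteq> a" "f i \<noteq> 2 * n + 2"
      using i fa(3) out by auto
    then show "g i = f i"
      using i by (simp add: g_def attach_pair_def conj_transpose_def transpose_def)
  qed
  have mem: "i \<in> up_evens g \<longleftrightarrow> (i = a \<and> even a) \<or> (i \<noteq> a \<and> i \<noteq> f a \<and> i \<in> up_evens f)" for i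
  proof -
    consider "i = a" | "i = f a" | "i = 2 * n + 1" | "i = 2 * n + 2"
      | "i \<notin> {a, 2 * n + 1, f a, 2 * n + 2}"
      by blast
    then show ?thesis
    proof cases
      case 5
      then show ?thesis
        by (simp add: up_evens_def g(5))
    qed (use a fa g out in \<open>simp_all add: up_evens_def\<close>)
  qed
  have "even a \<Longrightarrow> f a \<notin> up_evens f" "odd a \<Longrightarrow> a \<notin> up_evens f"
    using fa by (simp_all add: up_evens_def)
  then show ?thesis
    using False mem unfolding g_def[symmetric] by (auto simp: set_eq_iff)
qed

text \<open>
  Of the \<open>n\<close> even points up to \<open>2 n\<close>, those that already carry an upline keep the number when
  chosen as slot, and the others raise it; of the odd points, exactly the upper ends of uplines lower it.
\<close>

lemma counted_by_stat_poly_matchings: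
  "counted_by_stat_poly perfect_matchings num_uplines"
proof (rule counted_by_stat_poly_bij)
  show "bij_betw (\<lambda>f. (\<lambda>i. {i, f i}) ` {1..2 * n}) (matching_involutions {1..2 * n}) (perfect_matchings n)"
    for n
    unfolding perfect_matchings_def by (rule bij_betw_involution_matching)
  show "num_uplines ((\<lambda>i. {i, f i}) ` {1..2 * n}) = card (up_evens f)"
    if "f \<in> matching_involutions {1..2 * n}" for n f
    using that by (rule num_uplines_involution)
  show "counted_by_stat_poly (\<lambda>n. matching_involutions {1..2 * n}) (\<lambda>f. card (up_evens f))"
  proof (rule counted_by_stat_poly_if_balanced_growth[where S = "\<lambda>n. insert (2 * n + 2) {1..2 * n}"
        and ext = "\<lambda>n. attach_pair (2 * n + 1) (2 * n + 2)"
        and up = "\<lambda>n f. evens n - up_evens f" and down = "\<lambda>n f. f ` up_evens f"])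
    have "f = id" if "f \<in> matching_involutions {}" for f
      using that by (auto simp: matching_involutions_def)
    then show "matching_involutions {1..2 * 0} = {id}"
      by (auto simp: matching_involutions_def)
    show "bij_betw (\<lambda>(f, a). attach_pair (2 * n + 1) (2 * n + 2) f a)
        (matching_involutions {1..2 * n} \<times> insert (2 * n + 2) {1..2 * n})
        (matching_involutions {1..2 * Suc n})" for n
    proof -
      have "{1..2 * Suc n} = insert (2 * n + 1) (insert (2 * n + 2) {1..2 * n})"
        by auto
      then show ?thesis
        by (simp only:) (rule bij_betw_attach_pair; simp)
    qed
    fix n f assume f: "f \<in> matching_involutions {1..2 * n}"
    note sub = up_evens_subset[OF f]
    have fin: "finite (up_evens f)"
      using sub by (rule finite_subset) simp
    have range: "f i \<in> {1..2 * n}" "f (f i) = i" if "i \<in> {1..2 * n}" for i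
      using f that by (auto simp: matching_involutions_def)
    have inv: "i \<in> f ` up_evens f \<longleftrightarrow> f i \<in> up_evens f" if "i \<in> {1..2 * n}" for i
      using range that sub by (auto simp: evens_def intro!: rev_image_eqI[of "f i"])
    show "card (up_evens f) \<le> n"
      using card_mono[OF _ sub] by (simp add: card_evens)
    show "card (evens n - up_evens f) = n - card (up_evens f)"
      using sub fin by (simp add: card_Diff_subset card_evens)
    have "inj_on f (up_evens f)"
      using range(2) sub by (intro inj_on_inverseI[of _ f]) (auto simp: evens_def)
    then show "card (f ` up_evens f) = card (up_evens f)"
      by (rule card_image)
    show "f ` up_evens f \<subseteq> insert (2 * n + 2) {1..2 * n}"
      using range(1) sub by (auto simp: evens_def)
    show "(evens n - up_evens f) \<inter> f ` up_evens f = {}"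
      by (auto simp: evens_def up_evens_def)
    show "card (up_evens (attach_pair (2 * n + 1) (2 * n + 2) f a))
        = (if a \<in> evens n - up_evens f then Suc (card (up_evens f))
           else if a \<in> f ` up_evens f then card (up_evens f) - 1 else card (up_evens f))"
      if a: "a \<in> insert (2 * n + 2) {1..2 * n}" for a
    proof (cases "a = 2 * n + 2")
      case True
      then have "a \<notin> evens n" "a \<notin> f ` up_evens f"
        using range(1) sub by (fastforce simp: evens_def)+
      then show ?thesis
        unfolding up_evens_attach_pair[OF f a] using True by simp
    next
      case False
      then have "a \<in> {1..2 * n}"
        using a by simp
      then show ?thesis
      proof (cases "even a")
        case True
        then have "a \<notin> f ` up_evens f"
          by (auto simp: up_evens_def)
        then show ?thesis
          unfolding up_evens_attach_pair[OF f a]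
          using True False \<open>a \<in> {1..2 * n}\<close> fin by (simp add: evens_def card_insert_if)
      next
        case odd: False
        then show ?thesis
          unfolding up_evens_attach_pair[OF f a] inv[OF \<open>a \<in> {1..2 * n}\<close>]
          using False by (simp add: evens_def card_Diff_singleton_if)
      qed
    qed
  qed (auto simp: up_evens_def evens_def)
qed

section \<open>Families of child lists\<close>

text \<open>
  An increasing ordered tree is determined by the lists of children of its vertices, and the
  Klazar violators can be read off from these lists. In this form, inserting a leaf is the update of
  a function at one place.
\<close>

definition child_families :: "nat \<Rightarrow> (nat \<Rightarrow> nat list) set" where
  "child_families n =
     {c. (\<forall>v. distinct (c v) \<and> (\<forall>x\<in>set (c v). v < x \<and> x \<le> n)) \<and> (\<forall>x\<in>{1..n}. \<exists>!p. x \<in> set (c p))}"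

lemma child_familiesD:
  assumes "c \<in> child_families n"
  shows "distinct (c v)" and "x \<in> set (c v) \<Longrightarrow> v < x \<and> x \<le> n"
    and "x \<in> set (c p) \<Longrightarrow> x \<in> set (c q) \<Longrightarrow> p = q"
    and "1 \<le> x \<Longrightarrow> x \<le> n \<Longrightarrow> \<exists>p. x \<in> set (c p)"
proof -
  show range: "v < x \<and> x \<le> n" if "x \<in> set (c v)" for v
    using assms that unfolding child_families_def by blast
  have parent: "\<exists>!p. x \<in> set (c p)" if "1 \<le> x" "x \<le> n"
    using assms that by (simp add: child_families_def)
  show "p = q" if "x \<in> set (c p)" "x \<in> set (c q)"
  proof -
    have "1 \<le> x" "x \<le> n"
      using range[OF that(1)] by auto
    then show ?thesis
      using parent that by blast
  qed
  show "\<exists>p. x \<in> set (c p)" if "1 \<le> x" "x \<le> n"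
    using parent[OF that] by blast
  show "distinct (c v)"
    using assms by (simp add: child_families_def)
qed

lemma child_familiesI:
  assumes "\<And>v. distinct (c v)" and "\<And>v x. x \<in> set (c v) \<Longrightarrow> v < x \<and> x \<le> n"
    and "\<And>x. 1 \<le> x \<Longrightarrow> x \<le> n \<Longrightarrow> \<exists>!p. x \<in> set (c p)"
  shows "c \<in> child_families n"
  using assms by (simp add: child_families_def)

lemma child_families_insert_new:
  assumes c: "c \<in> child_families n" and "q \<le> n" and "c q = as @ bs"
  shows "c(q := as @ Suc n # bs) \<in> child_families (Suc n)"
proof -
  let ?d = "c(q := as @ Suc n # bs)"
  have mem: "x \<in> set (?d p) \<longleftrightarrow> x \<in> set (c p) \<or> x = Suc n \<and> p = q" for x p
    using assms(3) by auto
  have new: "Suc n \<notin> set (c p)" for p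
    using child_familiesD(2)[OF c, of "Suc n" p] by auto
  show ?thesis
  proof (rule child_familiesI)
    show "\<exists>!p. x \<in> set (?d p)" if "1 \<le> x" "x \<le> Suc n" for x
    proof (cases "x = Suc n")
      case True
      then show ?thesis
        unfolding mem using new by simp
    next
      case False
      then show ?thesis
        using that c unfolding mem by (simp add: child_families_def)
    qed
    show "distinct (?d v)" for v
      using child_familiesD(1)[OF c, of v] new[of q] assms(3) by auto
    show "v < x \<and> x \<le> Suc n" if "x \<in> set (?d v)" for v x
      using that child_familiesD(2)[OF c, of x v] assms(2) unfolding mem by auto
  qed
qed

text \<open>
  The largest label has no children, so it can be deleted from its list.
\<close>

lemma child_families_remove_new:
  assumes d: "d \<in> child_families (Suc n)"
  obtains c q as bs where "c \<in> child_families n" "q \<le> n" "c q = as @ bs" "d = c(q := as @ Suc n # bs)"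
proof -
  obtain q where q: "Suc n \<in> set (d q)"
    using child_familiesD(4)[OF d, of "Suc n"] by auto
  then obtain as bs where dq: "d q = as @ Suc n # bs"
    by (meson split_list)
  let ?c = "d(q := as @ bs)"
  have new: "Suc n \<notin> set (?c p)" for p
    using child_familiesD(1)[OF d, of q] child_familiesD(3)[OF d, OF q, of p] dq by auto
  have mem: "x \<in> set (?c p) \<longleftrightarrow> x \<in> set (d p) \<and> x \<noteq> Suc n" for x p
    using new[of p] dq by (auto split: if_splits)
  have "?c \<in> child_families n"
  proof (rule child_familiesI)
    show "\<exists>!p. x \<in> set (?c p)" if "1 \<le> x" "x \<le> n" for x
      using d that unfolding mem by (simp add: child_families_def)
    show "distinct (?c v)" for v
      using child_familiesD(1)[OF d, of v] child_familiesD(1)[OF d, of q] dq by auto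
    show "v < x \<and> x \<le> n" if "x \<in> set (?c v)" for v x
      using that child_familiesD(2)[OF d, of x v] unfolding mem by auto
  qed
  moreover have "q \<le> n"
    using child_familiesD(2)[OF d q] by auto
  moreover have "d = ?c(q := as @ Suc n # bs)"
    by (simp add: fun_upd_idem dq)
  ultimately show ?thesis
    using that[of ?c q as bs] by simp
qed

text \<open>
  The set of entries of the big cohort. The union over all \<open>p\<close> avoids a choice of the parent,
  which is unique if it exists.
\<close>

definition cohort :: "(nat \<Rightarrow> nat list) \<Rightarrow> nat \<Rightarrow> nat set" where
  "cohort c v = {b. \<exists>p. v \<in> set (c p)
      \<and> b \<in> set (takeWhile (\<lambda>w. v < w) (rev (takeWhile (\<lambda>w. w \<noteq> v) (c p))))}"

definition violators :: "(nat \<Rightarrow> nat list) \<Rightarrow> nat set" where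
  "violators c = {v. cohort c v \<noteq> {} \<and> (\<forall>s\<in>set (c v). \<exists>b\<in>cohort c v. b < s)}"

text \<open>
  These are the vertices, other than the root, for which it is settled whether they are
  violators: later leaves cannot change it, by \<open>violators_insert_new\<close>.
\<close>

definition busy :: "(nat \<Rightarrow> nat list) \<Rightarrow> nat set" where
  "busy c = {v. 1 \<le> v \<and> (cohort c v \<noteq> {} \<or> c v \<noteq> [])}"

lemma cohort_eq:
  assumes "c \<in> child_families n" and "v \<in> set (c p)"
  shows "cohort c v = set (takeWhile (\<lambda>w. v < w) (rev (takeWhile (\<lambda>w. w \<noteq> v) (c p))))"
  using child_familiesD(3)[OF assms(1)] assms(2) by (auto simp: cohort_def)

lemma cohort_gt: "b \<in> cohort c v \<Longrightarrow> v < b"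
  by (auto simp: cohort_def dest: set_takeWhileD)

lemma cohort_le:
  assumes "c \<in> child_families n" and "b \<in> cohort c v"
  shows "b \<le> n"
  using assms(2) child_familiesD(2)[OF assms(1)]
  by (auto simp: cohort_def dest!: set_takeWhileD)

lemma cohort_nonempty_range:
  assumes "c \<in> child_families n" and "cohort c v \<noteq> {}"
  shows "1 \<le> v" "v \<le> n"
proof -
  obtain p where "v \<in> set (c p)"
    using assms(2) by (auto simp: cohort_def)
  then have "p < v \<and> v \<le> n"
    by (rule child_familiesD(2)[OF assms(1)])
  then show "1 \<le> v" "v \<le> n"
    by auto
qed

lemma busy_subset:
  assumes "c \<in> child_families n"
  shows "busy c \<subseteq> {1..n}"
proof
  fix v assume v: "v \<in> busy c"
  have "v \<le> n"
  proof (cases "c v")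
    case Nil
    then show ?thesis
      using v cohort_nonempty_range[OF assms] by (auto simp: busy_def)
  next
    case (Cons s l)
    then show ?thesis
      using child_familiesD(2)[OF assms, of s v] by simp
  qed
  then show "v \<in> {1..n}"
    using v by (simp add: busy_def)
qed

lemma violators_subset_busy:
  assumes "c \<in> child_families n"
  shows "violators c \<subseteq> busy c"
  using cohort_nonempty_range[OF assms] by (auto simp: violators_def busy_def)

text \<open>
  The new label exceeds every \<open>v\<close>, so it joins the cohort of \<open>v\<close> exactly if the cohort extends
  to the place where it is inserted.
\<close>

lemma cohort_insert_new:
  assumes c: "c \<in> child_families n" and "q \<le> n" and cq: "c q = as @ bs" and "v \<le> n"
  shows "cohort (c(q := as @ Suc n # bs)) v
    = cohort c v \<union> (if v \<in> set bs \<and> (\<forall>b\<in>set (takeWhile (\<lambda>w. w \<noteq> v) bs). v < b) then {Suc n} else {})"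
proof (cases "v \<in> set bs")
  case True
  let ?d = "c(q := as @ Suc n # bs)"
  have d: "?d \<in> child_families (Suc n)"
    using child_families_insert_new[OF c assms(2,3)] .
  obtain cs where cs: "cs = takeWhile (\<lambda>w. w \<noteq> v) bs"
    by simp
  have "v \<notin> set as"
    using child_familiesD(1)[OF c, of q] cq True by auto
  then have before: "takeWhile (\<lambda>w. w \<noteq> v) (as @ l) = as @ takeWhile (\<lambda>w. w \<noteq> v) l" for l
    by (intro takeWhile_append2) auto
  have "cohort c v = set (takeWhile (\<lambda>w. v < w) (rev cs @ rev as))"
    using cohort_eq[OF c, of v q] True cq before by (simp add: cs)
  moreover have "cohort ?d v = set (takeWhile (\<lambda>w. v < w) (rev cs @ Suc n # rev as))"
    using cohort_eq[OF d, of v q] True before \<open>v \<le> n\<close> by (simp add: cs)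
  ultimately show ?thesis
    using True \<open>v \<le> n\<close> by (auto simp: takeWhile_append simp flip: cs)
next
  case False
  have "cohort (c(q := as @ Suc n # bs)) v = cohort c v"
  proof (cases "v \<in> set as")
    case True
    then have before: "takeWhile (\<lambda>w. w \<noteq> v) (as @ l) = takeWhile (\<lambda>w. w \<noteq> v) as" for l
      by (intro takeWhile_append1) auto
    show ?thesis
      using cohort_eq[OF c, of v q] True cq before
        cohort_eq[OF child_families_insert_new[OF c assms(2,3)], of v q]
      by simp
  next
    case outside: False
    let ?d = "c(q := as @ Suc n # bs)"
    have same: "(v \<in> set (?d p) \<and> Q (?d p)) \<longleftrightarrow> (v \<in> set (c p) \<and> Q (c p))" for p Q
      using outside False cq \<open>v \<le> n\<close> by (cases "p = q") auto
    show ?thesis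
      unfolding cohort_def
      by (intro Collect_cong ex_cong1)
        (rule same[where Q = "\<lambda>l. _ \<in> set (takeWhile (\<lambda>w. v < w) (rev (takeWhile (\<lambda>w. w \<noteq> v) l)))"])
  qed
  then show ?thesis
    using False by simp
qed

lemma cohort_new:
  assumes "c \<in> child_families n"
  shows "cohort c n = {}"
proof (rule equals0I)
  fix b assume "b \<in> cohort c n"
  then show False
    using cohort_gt[of b c n] cohort_le[OF assms, of b n] by simp
qed

text \<open>
  If the new label joins the cohort of \<open>v\<close> without being adjacent to \<open>v\<close>, then the left neighbour
  of \<open>v\<close> already belonged to the cohort.
\<close>

lemma cohort_insert_new_nonempty_iff:
  assumes c: "c \<in> child_families n" and "q \<le> n" and cq: "c q = as @ bs" and "v \<le> n"
  shows "cohort (c(q := as @ Suc n # bs)) v \<noteq> {} \<longleftrightarrow> cohort c v \<noteq> {} \<or> (\<exists>l. bs = v # l)"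
proof (cases "\<exists>l. bs = v # l")
  case True
  then show ?thesis
    unfolding cohort_insert_new[OF assms] by auto
next
  case False
  have "cohort c v \<noteq> {}" if v: "v \<in> set bs" and gt: "\<forall>b\<in>set (takeWhile (\<lambda>w. w \<noteq> v) bs). v < b"
  proof -
    obtain cs where cs: "cs = takeWhile (\<lambda>w. w \<noteq> v) bs"
      by simp
    have "v \<notin> set as"
      using child_familiesD(1)[OF c, of q] cq v by auto
    then have "takeWhile (\<lambda>w. w \<noteq> v) (as @ bs) = as @ cs"
      unfolding cs by (intro takeWhile_append2) auto
    then have "cohort c v = set (takeWhile (\<lambda>w. v < w) (rev cs @ rev as))"
      using cohort_eq[OF c, of v q] v cq by simp
    moreover have "cs \<noteq> []"
      using v False by (cases bs) (auto simp: cs)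
    moreover have "\<forall>b\<in>set cs. v < b"
      using gt by (simp add: cs)
    ultimately show ?thesis
      by (cases cs rule: rev_cases) auto
  qed
  then show ?thesis
    using False unfolding cohort_insert_new[OF assms] by auto
qed

lemma busy_insert_new:
  assumes c: "c \<in> child_families n" and "q \<le> n" and cq: "c q = as @ bs"
  shows "busy (c(q := as @ Suc n # bs)) = busy c \<union> {v. 1 \<le> v \<and> (v = q \<or> (\<exists>l. bs = v # l))}"
    (is "busy ?d = ?B")
proof (rule set_eqI)
  fix v
  have d: "?d \<in> child_families (Suc n)"
    using child_families_insert_new[OF assms] .
  have bs: "v \<le> n" if "bs = v # l" for l
    using child_familiesD(2)[OF c, of v q] cq that by simp
  consider "v \<le> n" | "v = Suc n" | "Suc n < v"
    by linarith
  then show "v \<in> busy ?d \<longleftrightarrow> v \<in> ?B"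
  proof cases
    case 1
    have "?d v \<noteq> [] \<longleftrightarrow> c v \<noteq> [] \<or> v = q"
      by simp
    then show ?thesis
      using cohort_insert_new_nonempty_iff[OF assms 1] by (auto simp: busy_def)
  next
    case 2
    have "x \<notin> set (?d v)" for x
      using child_familiesD(2)[OF d, of x v] 2 by linarith
    then have "?d v = []"
      by (metis list.set_intros(1) neq_Nil_conv)
    then have "v \<notin> busy ?d"
      using cohort_new[OF d] 2 by (simp add: busy_def)
    moreover have "v \<notin> ?B"
      using 2 busy_subset[OF c] \<open>q \<le> n\<close> bs by auto
    ultimately show ?thesis
      by blast
  next
    case 3
    then show ?thesis
      using busy_subset[OF c] busy_subset[OF d] \<open>q \<le> n\<close> bs by (auto dest!: subsetD)
  qed
qed

text \<open>
  Only \<open>associate < child\<close> could be affected by the new label, which is larger than all others. It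
  does not change the minimum of a nonempty cohort, and as a child it exceeds every associate. If it
  starts the cohort of \<open>v\<close>, it is the associate itself, so \<open>v\<close> becomes a violator if and only if \<open>v\<close>
  is a leaf.
\<close>

lemma violators_insert_new:
  assumes c: "c \<in> child_families n" and "q \<le> n" and cq: "c q = as @ bs"
  shows "violators (c(q := as @ Suc n # bs)) = violators c \<union> {v. v \<notin> busy c \<and> (\<exists>l. bs = v # l)}"
    (is "violators ?d = ?V")
proof (rule set_eqI)
  fix v
  have d: "?d \<in> child_families (Suc n)"
    using child_families_insert_new[OF assms] .
  have bs: "v \<le> n \<and> q < v" if "bs = v # l" for l
    using child_familiesD(2)[OF c, of v q] cq that by simp
  show "v \<in> violators ?d \<longleftrightarrow> v \<in> ?V"
  proof (cases "v \<le> n")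
    case True
    have cohort: "cohort c v \<subseteq> cohort ?d v" "cohort ?d v \<subseteq> insert (Suc n) (cohort c v)"
      unfolding cohort_insert_new[OF assms True] by auto
    have children: "set (c v) \<subseteq> set (?d v)" "set (?d v) \<subseteq> insert (Suc n) (set (c v))"
      using cq by auto
    have le: "b \<le> n" if "b \<in> cohort c v \<or> b \<in> set (c v)" for b
      using that cohort_le[OF c] child_familiesD(2)[OF c] by blast
    show ?thesis
    proof (cases "cohort c v = {}")
      case False
      have "v \<in> violators ?d \<longleftrightarrow> (\<forall>s\<in>set (?d v). \<exists>b\<in>cohort ?d v. b < s)"
        using False cohort(1) by (auto simp: violators_def)
      also have "\<dots> \<longleftrightarrow> (\<forall>s\<in>set (c v). \<exists>b\<in>cohort c v. b < s)"
      proof (intro iffI ballI)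
        fix s assume "\<forall>s\<in>set (?d v). \<exists>b\<in>cohort ?d v. b < s" and s: "s \<in> set (c v)"
        then obtain b where "b \<in> cohort ?d v" "b < s"
          using children(1) by blast
        moreover from this have "b \<noteq> Suc n"
          using le[of s] s by auto
        ultimately show "\<exists>b\<in>cohort c v. b < s"
          using cohort(2) by blast
      next
        fix s assume *: "\<forall>s\<in>set (c v). \<exists>b\<in>cohort c v. b < s" and "s \<in> set (?d v)"
        then consider "s = Suc n" | "s \<in> set (c v)"
          using children(2) by blast
        then have "\<exists>b\<in>cohort c v. b < s"
        proof cases
          case 1
          obtain b where "b \<in> cohort c v"
            using False by blast
          then show ?thesis
            using 1 le[of b] by (auto intro!: bexI[of _ b])
        qed (use * in blast)
        then show "\<exists>b\<in>cohort ?d v. b < s"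
          using cohort(1) by blast
      qed
      also have "\<dots> \<longleftrightarrow> v \<in> violators c"
        using False by (simp add: violators_def)
      finally have "v \<in> violators ?d \<longleftrightarrow> v \<in> violators c" .
      moreover have "v \<in> busy c"
        using False cohort_nonempty_range[OF c] by (auto simp: busy_def)
      ultimately show ?thesis
        by blast
    next
      case none: True
      have new_busy: "cohort ?d v \<noteq> {} \<longleftrightarrow> (\<exists>l. bs = v # l)"
        using cohort_insert_new_nonempty_iff[OF assms True] none by simp
      show ?thesis
      proof (cases "\<exists>l. bs = v # l")
        case l: True
        then have "cohort ?d v = {Suc n}"
          using new_busy cohort(2) none by blast
        moreover have "?d v = c v" "1 \<le> v"
          using l bs by auto
        ultimately have "v \<in> violators ?d \<longleftrightarrow> (\<forall>s\<in>set (c v). Suc n < s)"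
          by (simp add: violators_def)
        also have "\<dots> \<longleftrightarrow> c v = []"
        proof (cases "c v")
          case (Cons s l)
          then show ?thesis
            using le[of s] by auto
        qed simp
        finally show ?thesis
          using l none \<open>1 \<le> v\<close> by (auto simp: violators_def busy_def)
      qed (use new_busy none in \<open>auto simp: violators_def\<close>)
    qed
  next
    case False
    have "violators ?d \<subseteq> {1..Suc n}"
      using violators_subset_busy[OF d] busy_subset[OF d] by (rule subset_trans)
    moreover have "Suc n \<notin> violators ?d"
      using cohort_new[OF d] unfolding violators_def by blast
    ultimately have "v \<notin> violators ?d"
      using False by (metis atLeastAtMost_iff le_Suc_eq subsetD)
    moreover have "v \<notin> busy c"
      using False busy_subset[OF c] by auto
    then have "v \<notin> ?V"
      using False violators_subset_busy[OF c] bs by auto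
    ultimately show ?thesis
      by blast
  qed
qed

fun insert_before :: "'a \<Rightarrow> 'a \<Rightarrow> 'a list \<Rightarrow> 'a list" where
  "insert_before w x [] = []"
| "insert_before w x (a # l) = (if a = w then x # a # l else a # insert_before w x l)"

lemma insert_before_notin: "w \<notin> set l \<Longrightarrow> insert_before w x l = l"
  by (induction l) auto

lemma insert_before_append: "w \<notin> set as \<Longrightarrow> insert_before w x (as @ w # bs) = as @ x # w # bs"
  by (induction as) auto

text \<open>
  The leaf \<open>n + 1\<close> is placed immediately to the left of the vertex \<open>w\<close> for the slot \<open>Inl w\<close>, and
  as the last child of \<open>p\<close> for the slot \<open>Inr p\<close>. Since \<open>w\<close> occurs in one list only,
  \<open>insert_before\<close> may be applied to all lists, without mention of the parent of \<open>w\<close>.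
\<close>

definition add_leaf :: "nat \<Rightarrow> (nat \<Rightarrow> nat list) \<Rightarrow> nat + nat \<Rightarrow> nat \<Rightarrow> nat list" where
  "add_leaf n c s = (case s of
      Inl w \<Rightarrow> insert_before w (Suc n) \<circ> c
    | Inr p \<Rightarrow> c(p := c p @ [Suc n]))"

definition leaf_slots :: "nat \<Rightarrow> (nat + nat) set" where
  "leaf_slots n = {1..n} <+> {0..n}"

lemma add_leaf_Inl:
  assumes c: "c \<in> child_families n" and "Inl w \<in> leaf_slots n"
  obtains q as bs where "q \<le> n" "c q = as @ w # bs" "add_leaf n c (Inl w) = c(q := as @ Suc n # w # bs)"
proof -
  have "1 \<le> w" "w \<le> n"
    using assms(2) by (auto simp: leaf_slots_def)
  then obtain q where q: "w \<in> set (c q)"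
    using child_familiesD(4)[OF c] by blast
  then obtain as bs where cq: "c q = as @ w # bs" "w \<notin> set as"
    by (meson split_list_first)
  have "w \<notin> set (c p)" if "p \<noteq> q" for p
    using child_familiesD(3)[OF c q] that by blast
  then have "add_leaf n c (Inl w) = c(q := as @ Suc n # w # bs)"
    using cq by (auto simp: add_leaf_def insert_before_append insert_before_notin fun_eq_iff)
  moreover have "q \<le> n"
    using child_familiesD(2)[OF c q] by simp
  ultimately show ?thesis
    using that cq by blast
qed

lemma leaf_position_unique:
  assumes "d \<in> child_families n" and "d p = as @ x # r" and "d q = bs @ x # s"
  shows "p = q" "as = bs" "r = s"
proof -
  show "p = q"
    using child_familiesD(3)[OF assms(1), of x p q] assms(2,3) by simp
  then have "as @ x # r = bs @ x # s" "distinct (as @ x # r)"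
    using assms child_familiesD(1)[OF assms(1), of p] by auto
  then show "as = bs" "r = s"
    by (metis append_Cons_eq_iff distinct.simps(2) distinct_append not_distinct_conv_prefix)+
qed

lemma bij_betw_add_leaf:
  "bij_betw (\<lambda>(c, s). add_leaf n c s) (child_families n \<times> leaf_slots n) (child_families (Suc n))"
proof -
  \<comment> \<open>The slot can be recovered from the label that follows the new one, if there is any.\<close>
  have pos: "\<exists>q as bs. q \<le> n \<and> c q = as @ bs \<and> add_leaf n c s = c(q := as @ Suc n # bs)
      \<and> s = (case bs of [] \<Rightarrow> Inr q | w # _ \<Rightarrow> Inl w)"
    if c: "c \<in> child_families n" and s: "s \<in> leaf_slots n" for c s
  proof (cases s)
    case (Inl w)
    then show ?thesis
      using add_leaf_Inl[OF c, of w] s by (metis list.simps(5))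
  next
    case (Inr p)
    then show ?thesis
      using s by (intro exI[of _ p] exI[of _ "c p"] exI[of _ "[]"]) (auto simp: add_leaf_def leaf_slots_def)
  qed
  have "inj_on (\<lambda>(c, s). add_leaf n c s) (child_families n \<times> leaf_slots n)"
  proof (rule inj_onI, clarify)
    fix c s c' s'
    assume c: "c \<in> child_families n" and c': "c' \<in> child_families n"
      and s: "s \<in> leaf_slots n" and s': "s' \<in> leaf_slots n"
      and eq: "add_leaf n c s = add_leaf n c' s'"
    obtain q as bs where q: "q \<le> n" "c q = as @ bs" "add_leaf n c s = c(q := as @ Suc n # bs)"
      "s = (case bs of [] \<Rightarrow> Inr q | w # _ \<Rightarrow> Inl w)"
      using pos[OF c s] by blast
    obtain q' as' bs' where q': "q' \<le> n" "c' q' = as' @ bs'" "add_leaf n c' s' = c'(q' := as' @ Suc n # bs')"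
      "s' = (case bs' of [] \<Rightarrow> Inr q' | w # _ \<Rightarrow> Inl w)"
      using pos[OF c' s'] by blast
    define d where "d = add_leaf n c s"
    have d: "d = c(q := as @ Suc n # bs)" and d': "d = c'(q' := as' @ Suc n # bs')"
      using q(3) q'(3) eq by (simp_all only: d_def)
    have "d q = as @ Suc n # bs" "d q' = as' @ Suc n # bs'"
      by (subst d, simp) (subst d', simp)
    moreover have "d \<in> child_families (Suc n)"
      unfolding d by (rule child_families_insert_new[OF c q(1,2)])
    ultimately have same: "q' = q" "as' = as" "bs' = bs"
      using leaf_position_unique[of d "Suc n" q' as' "Suc n" bs' q as bs] by blast+
    have "c = d(q := as @ bs)"
      unfolding d using q(2) by (simp add: fun_upd_idem)
    moreover have "c' = d(q := as @ bs)"
      unfolding d' same using q'(2) by (simp add: fun_upd_idem same)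
    ultimately show "c = c' \<and> s = s'"
      using q(4) q'(4) same(1,3) by (cases bs) simp_all
  qed
  moreover have "(\<lambda>(c, s). add_leaf n c s) ` (child_families n \<times> leaf_slots n) = child_families (Suc n)"
  proof (intro equalityI subsetI)
    fix d assume "d \<in> (\<lambda>(c, s). add_leaf n c s) ` (child_families n \<times> leaf_slots n)"
    then obtain c s where c: "c \<in> child_families n" and s: "s \<in> leaf_slots n" and d: "d = add_leaf n c s"
      by auto
    then show "d \<in> child_families (Suc n)"
      using pos[OF c s] child_families_insert_new[OF c] by auto
  next
    fix d assume "d \<in> child_families (Suc n)"
    then obtain c q as bs where c: "c \<in> child_families n" and q: "q \<le> n" "c q = as @ bs"
      and d: "d = c(q := as @ Suc n # bs)"
      by (rule child_families_remove_new)
    have "\<exists>s. s \<in> leaf_slots n \<and> d = add_leaf n c s"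
    proof (cases bs)
      case Nil
      then show ?thesis
        using q d by (intro exI[of _ "Inr q"]) (auto simp: add_leaf_def leaf_slots_def)
    next
      case (Cons w l)
      then have w: "Inl w \<in> leaf_slots n"
        using child_familiesD(2)[OF c, of w q] q by (auto simp: leaf_slots_def)
      then obtain q' as' bs' where q': "c q' = as' @ w # bs'"
        and eq: "add_leaf n c (Inl w) = c(q' := as' @ Suc n # w # bs')"
        using add_leaf_Inl[OF c] by blast
      then have "q = q'" "as = as'" "l = bs'"
        using leaf_position_unique[OF c q(2)[unfolded Cons] q'] by simp_all
      then show ?thesis
        using w eq d Cons by auto
    qed
    then obtain s where "s \<in> leaf_slots n" "d = add_leaf n c s"
      by blast
    then show "d \<in> (\<lambda>(c, s). add_leaf n c s) ` (child_families n \<times> leaf_slots n)"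
      using c by (intro image_eqI[of _ _ "(c, s)"]) simp_all
  qed
  ultimately show ?thesis
    by (simp add: bij_betw_def)
qed

lemma busy_violators_add_leaf_Inl:
  assumes c: "c \<in> child_families n" and w: "Inl w \<in> leaf_slots n"
  shows "busy (add_leaf n c (Inl w)) = insert w (busy c)"
    and "violators (add_leaf n c (Inl w)) = (if w \<in> busy c then violators c else insert w (violators c))"
proof -
  obtain q as bs where q: "q \<le> n" "c q = as @ w # bs"
    and eq: "add_leaf n c (Inl w) = c(q := as @ Suc n # w # bs)"
    using add_leaf_Inl[OF assms] .
  have "1 \<le> q \<Longrightarrow> q \<in> busy c"
    using q(2) by (simp add: busy_def)
  moreover have "1 \<le> w"
    using w by (auto simp: leaf_slots_def)
  ultimately show "busy (add_leaf n c (Inl w)) = insert w (busy c)"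
    unfolding eq busy_insert_new[OF c q] by auto
  show "violators (add_leaf n c (Inl w)) = (if w \<in> busy c then violators c else insert w (violators c))"
    unfolding eq violators_insert_new[OF c q] by auto
qed

lemma busy_violators_add_leaf_Inr:
  assumes c: "c \<in> child_families n" and p: "p \<le> n"
  shows "busy (add_leaf n c (Inr p)) = (if p = 0 then busy c else insert p (busy c))"
    and "violators (add_leaf n c (Inr p)) = violators c"
  using busy_insert_new[OF c p, of "c p" "[]"] violators_insert_new[OF c p, of "c p" "[]"]
  by (auto simp: add_leaf_def)

text \<open>
  A vertex \<open>w\<close> that is not busy offers the slot to its left, which makes it busy and a violator, and the
  slot below it, which makes it busy only; together they give the factor \<open>1 + Y\<close>. The
  slots at busy vertices and below the root, \<open>2 b + 1\<close> in number, change nothing.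
\<close>

lemma sum_leaf_slots:
  fixes h :: "nat \<Rightarrow> rat poly"
  assumes c: "c \<in> child_families n"
  shows "(\<Sum>s\<in>leaf_slots n. Y ^ card (violators (add_leaf n c s)) * h (card (busy (add_leaf n c s))))
    = Y ^ card (violators c) * (of_nat (2 * card (busy c) + 1) * h (card (busy c))
        + of_nat (n - card (busy c)) * ((1 + Y) * h (Suc (card (busy c)))))"
    (is "sum ?weight _ = _")
proof -
  let ?b = "card (busy c)" and ?v = "card (violators c)"
  have fin: "finite (busy c)" "finite (violators c)"
    using busy_subset[OF c] violators_subset_busy[OF c] by (meson finite_atLeastAtMost finite_subset)+
  have split: "(\<Sum>w\<in>{1..n}. if w \<in> busy c then x else y) = of_nat ?b * x + of_nat (n - ?b) * y"
    for x y :: "rat poly"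
  proof -
    have "{1..n} \<inter> {w. w \<in> busy c} = busy c" "{1..n} \<inter> - {w. w \<in> busy c} = {1..n} - busy c"
      using busy_subset[OF c] by auto
    then show ?thesis
      using busy_subset[OF c] fin by (simp add: sum.If_cases card_Diff_subset)
  qed
  have "(\<Sum>w\<in>{1..n}. ?weight (Inl w))
      = (\<Sum>w\<in>{1..n}. if w \<in> busy c then Y ^ ?v * h ?b else Y ^ Suc ?v * h (Suc ?b))"
  proof (intro sum.cong refl)
    fix w assume "w \<in> {1..n}"
    then have w: "Inl w \<in> leaf_slots n"
      by (auto simp: leaf_slots_def)
    have "w \<notin> violators c" if "w \<notin> busy c"
      using that violators_subset_busy[OF c] by blast
    then show "?weight (Inl w) = (if w \<in> busy c then Y ^ ?v * h ?b else Y ^ Suc ?v * h (Suc ?b))"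
      using fin by (simp add: busy_violators_add_leaf_Inl[OF c w] insert_absorb)
  qed
  moreover have "(\<Sum>p\<in>{0..n}. ?weight (Inr p))
      = Y ^ ?v * h ?b + (\<Sum>p\<in>{1..n}. if p \<in> busy c then Y ^ ?v * h ?b else Y ^ ?v * h (Suc ?b))"
  proof -
    have "{0..n} = insert 0 {1..n}"
      by auto
    then have "(\<Sum>p\<in>{0..n}. ?weight (Inr p)) = ?weight (Inr 0) + (\<Sum>p\<in>{1..n}. ?weight (Inr p))"
      by simp
    also have "?weight (Inr 0) = Y ^ ?v * h ?b"
      by (simp add: busy_violators_add_leaf_Inr[OF c])
    also have "(\<Sum>p\<in>{1..n}. ?weight (Inr p))
        = (\<Sum>p\<in>{1..n}. if p \<in> busy c then Y ^ ?v * h ?b else Y ^ ?v * h (Suc ?b))"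
      using fin by (intro sum.cong) (simp_all add: busy_violators_add_leaf_Inr[OF c] insert_absorb)
    finally show ?thesis .
  qed
  moreover have "sum ?weight (leaf_slots n)
      = (\<Sum>w\<in>{1..n}. ?weight (Inl w)) + (\<Sum>p\<in>{0..n}. ?weight (Inr p))"
    unfolding leaf_slots_def by (subst sum.Plus) simp_all
  ultimately show ?thesis
    unfolding split by (simp add: algebra_simps)
qed

text \<open>
  The number of families with \<open>j\<close> busy vertices is \<open>2\<^sup>j\<close> times this coefficient.
\<close>

fun tree_coeff :: "nat \<Rightarrow> nat \<Rightarrow> nat" where
  "tree_coeff 0 j = (if j = 0 then 1 else 0)"
| "tree_coeff (Suc n) j = (2 * j + 1) * tree_coeff n j
     + (case j of 0 \<Rightarrow> 0 | Suc i \<Rightarrow> (n - i) * tree_coeff n i)"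

lemma tree_coeff_eq_0: "n < j \<Longrightarrow> tree_coeff n j = 0"
  by (induction n arbitrary: j) (auto split: nat.split)

lemma sum_tree_coeff_Suc:
  fixes h :: "nat \<Rightarrow> 'a::comm_semiring_1"
  shows "(\<Sum>j\<le>Suc n. of_nat (tree_coeff (Suc n) j) * h j)
     = (\<Sum>j\<le>n. of_nat (tree_coeff n j) * (of_nat (2 * j + 1) * h j + of_nat (n - j) * h (Suc j)))"
  unfolding tree_coeff.simps
  by (rule sum_triangle_Suc[where c = "tree_coeff n"]) (simp add: tree_coeff_eq_0)

lemma child_families_0: "child_families 0 = {\<lambda>_. []}"
proof (intro equalityI subsetI)
  fix c assume c: "c \<in> child_families 0"
  have "x \<notin> set (c v)" for x v
    using child_familiesD(2)[OF c, of x v] by linarith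
  then have "c v = []" for v
    by (metis list.set_intros(1) neq_Nil_conv)
  then show "c \<in> {\<lambda>_. []}"
    by (simp add: fun_eq_iff)
qed (simp add: child_families_def)

lemma finite_child_families: "finite (child_families n)"
proof (induction n)
  case (Suc n)
  have "finite (leaf_slots n)"
    by (simp add: leaf_slots_def)
  then show ?case
    using bij_betw_finite[OF bij_betw_add_leaf[of n]] Suc by simp
qed (simp add: child_families_0)

text \<open>
  Among the families with \<open>j\<close> busy vertices, the violators are distributed like the subsets
  of a set of \<open>j\<close> elements. The weight \<open>h\<close> is arbitrary because inserting one leaf
  replaces it by another weight, to which the induction hypothesis is applied.
\<close>

lemma sum_child_families:
  fixes h :: "nat \<Rightarrow> rat poly"
  shows "(\<Sum>c\<in>child_families n. Y ^ card (violators c) * h (card (busy c)))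
    = (\<Sum>j\<le>n. of_nat (tree_coeff n j) * ((1 + Y) ^ j * h j))"
proof (induction n arbitrary: h)
  case 0
  have "violators (\<lambda>_. []) = {}" "busy (\<lambda>_. []) = {}"
    by (auto simp: violators_def busy_def cohort_def)
  then show ?case
    by (simp add: child_families_0)
next
  case (Suc n)
  define H where "H j = of_nat (2 * j + 1) * h j + of_nat (n - j) * ((1 + Y) * h (Suc j))" for j
  have "(\<Sum>c\<in>child_families (Suc n). Y ^ card (violators c) * h (card (busy c)))
      = (\<Sum>c\<in>child_families n. Y ^ card (violators c) * H (card (busy c)))"
    unfolding sum_over_extensions[OF bij_betw_add_leaf] H_def
    by (intro sum.cong refl sum_leaf_slots)
  also have "\<dots> = (\<Sum>j\<le>n. of_nat (tree_coeff n j) * ((1 + Y) ^ j * H j))"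
    by (rule Suc.IH)
  also have "\<dots> = (\<Sum>j\<le>n. of_nat (tree_coeff n j) *
      (of_nat (2 * j + 1) * ((1 + Y) ^ j * h j) + of_nat (n - j) * ((1 + Y) ^ Suc j * h (Suc j))))"
    by (intro sum.cong refl) (simp add: H_def algebra_simps)
  also have "\<dots> = (\<Sum>j\<le>Suc n. of_nat (tree_coeff (Suc n) j) * ((1 + Y) ^ j * h j))"
    by (rule sum_tree_coeff_Suc[symmetric])
  finally show ?case .
qed

text \<open>
  In powers of \<open>1 + Y\<close> the operator \<open>stat_step n\<close> has the coefficients \<open>2 j + 1\<close> and \<open>n - j\<close> of the
  insertion of a leaf.
\<close>

lemma stat_poly_eq_sum_tree_coeff:
  "stat_poly n = (\<Sum>j\<le>n. of_nat (tree_coeff n j) * (1 + Y) ^ j)"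
proof (induction n)
  case (Suc n)
  have step: "stat_step n ((1 + Y) ^ j)
      = of_nat (2 * j + 1) * (1 + Y) ^ j + of_nat (n - j) * (1 + Y) ^ Suc j" if "j \<le> n" for j
  proof -
    obtain i where n: "n = j + i"
      using \<open>j \<le> n\<close> le_Suc_ex by blast
    have "1 - Y\<^sup>2 = (1 - Y) * (1 + Y)"
      by (simp add: power2_eq_square algebra_simps)
    then have "(1 - Y\<^sup>2) * pderiv ((1 + Y) ^ j) = (1 - Y) * ((1 + Y) * pderiv ((1 + Y) ^ j))"
      by (simp only: mult.assoc)
    also have "\<dots> = (1 - Y) * (of_nat j * (1 + Y) ^ j)"
      by (simp add: mult_pderiv_power pderiv_add)
    finally show ?thesis
      by (simp add: stat_step_def n algebra_simps)
  qed
  have "stat_poly (Suc n) = (\<Sum>j\<le>n. of_nat (tree_coeff n j) * stat_step n ((1 + Y) ^ j))"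
    by (simp only: stat_poly.simps Suc.IH stat_step_sum stat_step_of_nat)
  also have "\<dots> = (\<Sum>j\<le>n. of_nat (tree_coeff n j) *
      (of_nat (2 * j + 1) * (1 + Y) ^ j + of_nat (n - j) * (1 + Y) ^ Suc j))"
    by (intro sum.cong refl arg_cong2[where f = "(*)"] step) simp
  also have "\<dots> = (\<Sum>j\<le>Suc n. of_nat (tree_coeff (Suc n) j) * (1 + Y) ^ j)"
    by (rule sum_tree_coeff_Suc[where h = "\<lambda>j. (1 + Y) ^ j", symmetric])
  finally show ?case .
qed simp

lemma counted_by_stat_poly_child_families:
  "counted_by_stat_poly child_families (\<lambda>c. card (violators c))"
  unfolding counted_by_stat_poly_def
  using sum_child_families[where h = "\<lambda>_. 1"]
  by (simp add: finite_child_families stat_poly_eq_sum_tree_coeff)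

section \<open>Increasing ordered trees\<close>

lemma root_label_in_labels [simp]: "root_label t \<in> set (labels t)"
  by (cases t) simp

lemma root_label_le:
  "increasing t \<Longrightarrow> v \<in> set (labels t) \<Longrightarrow> root_label t \<le> v"
proof (induction t)
  case (OTree u ts)
  show ?case
  proof (cases "v = u")
    case False
    then obtain s where "s \<in> set ts" "v \<in> set (labels s)"
      using OTree.prems by auto
    then show ?thesis
      using OTree.IH[of s] OTree.prems(1) by fastforce
  qed simp
qed

lemma concat_map_single:
  assumes "\<And>t. t \<in> set as \<union> set bs \<Longrightarrow> f t = []"
  shows "concat (map f (as @ s # bs)) = f s"
proof -
  have "concat (map f as) = []" "concat (map f bs) = []"
    using assms by simp_all
  then show ?thesis
    by (simp only: map_append list.map concat_append concat.simps append_Nil append_Nil2)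
qed

lemma children_notin: "v \<notin> set (labels t) \<Longrightarrow> children t v = []"
  by (induction t) auto

lemma left_siblings_notin: "v \<notin> set (labels t) \<Longrightarrow> left_siblings t v = []"
proof (induction t)
  case (OTree u ts)
  have "v \<noteq> root_label s" if "s \<in> set ts" for s
    using OTree.prems that root_label_in_labels[of s] by auto
  then show ?case
    using OTree by auto
qed

text \<open>
  With distinct labels, a vertex lies in one subtree only. This is what makes the
  concatenations in \<open>children\<close> and \<open>left_siblings\<close> reduce to a single list.
\<close>

lemma distinct_labels_split:
  assumes "distinct (labels (OTree u ts))" and "s \<in> set ts"
  obtains as bs where "ts = as @ s # bs"
    "\<And>v. v \<in> set (labels s) \<Longrightarrow> v \<noteq> u \<and> (\<forall>t\<in>set as \<union> set bs. v \<notin> set (labels t))"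
proof -
  obtain as bs where ts: "ts = as @ s # bs"
    using split_list[OF assms(2)] by blast
  have "v \<noteq> u \<and> (\<forall>t\<in>set as \<union> set bs. v \<notin> set (labels t))" if "v \<in> set (labels s)" for v
    using assms(1) that unfolding ts by auto
  then show ?thesis
    using that ts by blast
qed

lemma distinct_labels_subtree:
  "distinct (labels (OTree u ts)) \<Longrightarrow> s \<in> set ts \<Longrightarrow> distinct (labels s)"
  by (auto simp: distinct_concat_iff)

lemma distinct_labels_unique_subtree:
  assumes "distinct (labels (OTree u ts))" "s \<in> set ts" "t \<in> set ts"
    and "v \<in> set (labels s)" "v \<in> set (labels t)"
  shows "s = t"
  using distinct_labels_split[OF assms(1,2)] assms(3-5)
  by (metis Un_iff in_set_conv_decomp set_append set_ConsD)

lemma children_subtree: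
  assumes "distinct (labels (OTree u ts))" and "s \<in> set ts" and "v \<in> set (labels s)"
  shows "children (OTree u ts) v = children s v"
proof -
  obtain as bs where ts: "ts = as @ s # bs" and "v \<noteq> u"
    and others: "\<forall>t\<in>set as \<union> set bs. v \<notin> set (labels t)"
    using distinct_labels_split[OF assms(1,2)] assms(3) by metis
  have "children (OTree u ts) v = concat (map (\<lambda>t. children t v) ts)"
    using \<open>v \<noteq> u\<close> by simp
  also have "\<dots> = children s v"
    unfolding ts using others by (intro concat_map_single children_notin) blast
  finally show ?thesis .
qed

lemma children_subset_labels:
  "distinct (labels t) \<Longrightarrow> x \<in> set (children t v) \<Longrightarrow> x \<in> set (labels t) \<and> x \<noteq> root_label t"
proof (induction t)
  case (OTree u ts)
  show ?case
  proof (cases "v = u")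
    case True
    then obtain s where s: "s \<in> set ts" and "x = root_label s"
      using OTree.prems(2) by auto
    then have "x \<in> set (labels s)"
      by simp
    then show ?thesis
      using OTree.prems(1) s by auto
  next
    case False
    then obtain s where s: "s \<in> set ts" "x \<in> set (children s v)"
      using OTree.prems(2) by auto
    then have "x \<in> set (labels s)"
      using OTree.IH[OF s(1)] distinct_labels_subtree[OF OTree.prems(1)] by blast
    then show ?thesis
      using OTree.prems(1) s(1) by auto
  qed
qed

lemma children_cases:
  assumes "distinct (labels (OTree u ts))" and "x \<in> set (children (OTree u ts) p)"
  obtains (root) s where "p = u" "s \<in> set ts" "x = root_label s"
  | (subtree) s where "p \<noteq> u" "s \<in> set ts" "p \<in> set (labels s)" "x \<in> set (children s p)"
      "x \<in> set (labels s)" "x \<noteq> root_label s"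
proof (cases "p = u")
  case True
  then show ?thesis
    using root assms(2) by auto
next
  case False
  then obtain s where s: "s \<in> set ts" "x \<in> set (children s p)"
    using assms(2) by auto
  moreover have "p \<in> set (labels s)"
    using children_notin[of p s] s(2) by fastforce
  moreover have "x \<in> set (labels s) \<and> x \<noteq> root_label s"
    using children_subset_labels[OF distinct_labels_subtree[OF assms(1) s(1)] s(2)] .
  ultimately show ?thesis
    using subtree False by blast
qed

lemma parent_unique:
  "distinct (labels t) \<Longrightarrow> x \<in> set (children t p) \<Longrightarrow> x \<in> set (children t q) \<Longrightarrow> p = q"
proof (induction t)
  case (OTree u ts)
  note same = distinct_labels_unique_subtree[OF OTree.prems(1), of _ _ x]
  show ?case
    using OTree.prems(1,2)
  proof (cases rule: children_cases)
    case p: (root s)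
    show ?thesis
      using OTree.prems(1,3)
    proof (cases rule: children_cases)
      case (subtree s')
      then show ?thesis
        using p same[of s s'] by auto
    qed (use p in simp)
  next
    case p: (subtree s)
    show ?thesis
      using OTree.prems(1,3)
    proof (cases rule: children_cases)
      case (root s')
      then show ?thesis
        using p same[of s s'] by auto
    next
      case (subtree s')
      then have "s' = s"
        using p same[of s' s] by blast
      then show ?thesis
        using OTree.IH[OF p(2) distinct_labels_subtree[OF OTree.prems(1) p(2)]] p subtree by blast
    qed
  qed
qed

lemma parent_exists:
  "distinct (labels t) \<Longrightarrow> x \<in> set (labels t) \<Longrightarrow> x \<noteq> root_label t \<Longrightarrow> \<exists>p. x \<in> set (children t p)"
proof (induction t)
  case (OTree u ts)
  then obtain s where s: "s \<in> set ts" "x \<in> set (labels s)"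
    by auto
  show ?case
  proof (cases "x = root_label s")
    case True
    then have "x \<in> set (children (OTree u ts) u)"
      using s by simp
    then show ?thesis
      by blast
  next
    case False
    then obtain p where p: "x \<in> set (children s p)"
      using OTree.IH[OF s(1) distinct_labels_subtree[OF OTree.prems(1) s(1)] s(2)] by blast
    then have "p \<in> set (labels s)"
      using children_notin[of p s] by fastforce
    then show ?thesis
      using children_subtree[OF OTree.prems(1) s(1)] p by metis
  qed
qed

lemma distinct_map_root_label:
  "distinct (concat (map labels ts)) \<Longrightarrow> distinct (map root_label ts)"
proof (induction ts)
  case (Cons t ts)
  have "root_label t \<noteq> root_label s" if "s \<in> set ts" for s
    using Cons.prems that root_label_in_labels[of t] root_label_in_labels[of s]
    by (simp del: root_label_in_labels) (metis UN_I disjoint_iff)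
  then show ?case
    using Cons by auto
qed simp

lemma distinct_children: "distinct (labels t) \<Longrightarrow> distinct (children t v)"
proof (induction t)
  case (OTree u ts)
  consider "v = u" | s where "s \<in> set ts" "v \<in> set (labels s)" | "v \<notin> set (labels (OTree u ts))"
    by auto
  then show ?case
  proof cases
    case 1
    then show ?thesis
      using OTree.prems distinct_map_root_label[of ts] by simp
  next
    case 2
    then show ?thesis
      using OTree.IH[OF 2(1) distinct_labels_subtree[OF OTree.prems 2(1)]]
        children_subtree[OF OTree.prems 2] by simp
  next
    case 3
    then show ?thesis
      unfolding children_notin[OF 3] by simp
  qed
qed

lemma child_greater:
  "distinct (labels t) \<Longrightarrow> increasing t \<Longrightarrow> x \<in> set (children t v) \<Longrightarrow> v < x"
proof (induction t)
  case (OTree u ts)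
  show ?case
    using OTree.prems(1,3)
  proof (cases rule: children_cases)
    case (root s)
    then show ?thesis
      using OTree.prems(2) by simp
  next
    case (subtree s)
    then show ?thesis
      using OTree.IH[OF subtree(2) distinct_labels_subtree[OF OTree.prems(1) subtree(2)]] OTree.prems(2)
      by simp
  qed
qed

lemma left_siblings_eq:
  "distinct (labels t) \<Longrightarrow> v \<in> set (children t p)
     \<Longrightarrow> left_siblings t v = takeWhile (\<lambda>w. w \<noteq> v) (children t p)"
proof (induction t)
  case (OTree u ts)
  show ?case
    using OTree.prems
  proof (cases rule: children_cases)
    case (root s)
    then show ?thesis
      by simp
  next
    case (subtree s)
    have "v \<noteq> root_label t" if "t \<in> set ts" for t
      using distinct_labels_unique_subtree[OF OTree.prems(1) that subtree(2), of v] subtree(5,6)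
      by auto
    then have "left_siblings (OTree u ts) v = concat (map (\<lambda>t. left_siblings t v) ts)"
      by auto
    also have "\<dots> = left_siblings s v"
    proof -
      obtain as bs where ts: "ts = as @ s # bs"
        and others: "\<forall>t\<in>set as \<union> set bs. v \<notin> set (labels t)"
        using distinct_labels_split[OF OTree.prems(1) subtree(2)] subtree(5) by metis
      show ?thesis
        unfolding ts using others by (intro concat_map_single left_siblings_notin) blast
    qed
    also have "\<dots> = takeWhile (\<lambda>w. w \<noteq> v) (children s p)"
      using OTree.IH[OF subtree(2) distinct_labels_subtree[OF OTree.prems(1) subtree(2)] subtree(4)] .
    finally show ?thesis
      by (simp only: children_subtree[OF OTree.prems(1) subtree(2,3)])
  qed
qed

lemma left_siblings_root: "distinct (labels t) \<Longrightarrow> left_siblings t (root_label t) = []"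
proof (cases t)
  case (OTree u ts)
  assume "distinct (labels t)"
  then have "u \<notin> set (labels s)" if "s \<in> set ts" for s
    using OTree that by auto
  moreover from this have "u \<noteq> root_label s" if "s \<in> set ts" for s
    using that root_label_in_labels[of s] by metis
  ultimately show ?thesis
    using OTree by (auto simp: left_siblings_notin)
qed

lemma increasing_ordered_treesD:
  assumes "t \<in> increasing_ordered_trees n"
  shows "increasing t" "distinct (labels t)" "set (labels t) = {0..n}" "root_label t = 0"
proof -
  show "increasing t" "distinct (labels t)" and labels: "set (labels t) = {0..n}"
    using assms by (simp_all add: increasing_ordered_trees_def)
  then show "root_label t = 0"
    using root_label_le[of t 0] by simp
qed

lemma children_in_child_families:
  assumes "t \<in> increasing_ordered_trees n"
  shows "children t \<in> child_families n"
proof (rule child_familiesI)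
  note t = increasing_ordered_treesD[OF assms]
  show "distinct (children t v)" for v
    using t(2) by (rule distinct_children)
  show "v < x \<and> x \<le> n" if "x \<in> set (children t v)" for v x
    using child_greater[OF t(2,1) that] children_subset_labels[OF t(2) that] t(3) by simp
  show "\<exists>!p. x \<in> set (children t p)" if "1 \<le> x" "x \<le> n" for x
    using parent_exists[OF t(2), of x] parent_unique[OF t(2), of x] that t(3,4)
    by (metis atLeastAtMost_iff le0 not_one_le_zero)
qed

text \<open>
  A left inverse of \<open>children\<close>. The first argument bounds the depth of the recursion, which need
  not end for an arbitrary function \<open>c\<close>.
\<close>

primrec tree_of_children :: "nat \<Rightarrow> (nat \<Rightarrow> nat list) \<Rightarrow> nat \<Rightarrow> otree" where
  "tree_of_children 0 c v = OTree v []"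
| "tree_of_children (Suc k) c v = OTree v (map (tree_of_children k c) (c v))"

lemma tree_of_children_eq:
  assumes "distinct (labels t)" and "length (labels t) \<le> k"
    and "\<And>v. v \<in> set (labels t) \<Longrightarrow> c v = children t v"
  shows "tree_of_children k c (root_label t) = t"
  using assms
proof (induction t arbitrary: k)
  case (OTree u ts)
  then obtain m where k: "k = Suc m"
    by (cases k) auto
  have "tree_of_children m c (root_label s) = s" if s: "s \<in> set ts" for s
  proof (rule OTree.IH[OF s distinct_labels_subtree[OF OTree.prems(1) s]])
    obtain as bs where "ts = as @ s # bs"
      using split_list[OF s] by blast
    then show "length (labels s) \<le> m"
      using OTree.prems(2) k by simp
    show "c v = children s v" if "v \<in> set (labels s)" for v
      using OTree.prems(3)[of v] children_subtree[OF OTree.prems(1) s that] s that by auto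
  qed
  then have "map (tree_of_children m c \<circ> root_label) ts = ts"
    by (simp add: map_idI)
  then show ?case
    using OTree.prems(3)[of u] by (simp add: k)
qed

lemma inj_on_children: "inj_on children (increasing_ordered_trees n)"
proof (rule inj_onI)
  fix s t assume s: "s \<in> increasing_ordered_trees n" and t: "t \<in> increasing_ordered_trees n"
    and eq: "children s = children t"
  have rebuild: "tree_of_children (Suc n) (children r) 0 = r" if "r \<in> increasing_ordered_trees n" for r
  proof -
    note r = increasing_ordered_treesD[OF that]
    have "length (labels r) = Suc n"
      using distinct_card[OF r(2)] r(3) by simp
    then show ?thesis
      using tree_of_children_eq[OF r(2), of "Suc n" "children r"] r(4) by simp
  qed
  show "s = t"
    using rebuild[OF s] rebuild[OF t] eq by simp
qed

fun graft :: "nat \<Rightarrow> nat \<Rightarrow> nat \<Rightarrow> otree \<Rightarrow> otree" where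
  "graft q k x (OTree u ts) =
     OTree u (if u = q then take k ts @ OTree x [] # drop k ts else map (graft q k x) ts)"

lemma root_label_graft [simp]: "root_label (graft q k x t) = root_label t"
  by (cases t) simp

lemma graft_notin: "q \<notin> set (labels t) \<Longrightarrow> graft q k x t = t"
  by (induction t) (auto intro!: map_idI)

lemma graft_properties:
  assumes "distinct (labels t)" and "q \<in> set (labels t)"
  shows "mset (labels (graft q k x t)) = add_mset x (mset (labels t))
    \<and> (increasing t \<longrightarrow> q < x \<longrightarrow> increasing (graft q k x t))
    \<and> children (graft q k x t) = (children t)(q := take k (children t q) @ x # drop k (children t q))"
  using assms
proof (induction t)
  case (OTree u ts)
  show ?case
  proof (cases "u = q")
    case True
    have split: "concat (map f ts) = concat (map f (take k ts)) @ concat (map f (drop k ts))"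
      for f :: "otree \<Rightarrow> nat list"
      by (metis append_take_drop_id concat_append map_append)
    have "mset (labels (graft q k x (OTree u ts))) = add_mset x (mset (labels (OTree u ts)))"
      using True by (simp add: split)
    moreover have "increasing (graft q k x (OTree u ts))" if "increasing (OTree u ts)" "q < x"
      using True that by (auto dest: in_set_takeD in_set_dropD)
    moreover have "children (graft q k x (OTree u ts)) v
        = ((children (OTree u ts))(q := take k (children (OTree u ts) q) @ x # drop k (children (OTree u ts) q))) v"
      for v
      using True by (simp add: take_map drop_map split[of "\<lambda>t. children t v"])
    ultimately show ?thesis
      by blast
  next
    case False
    then obtain s where s: "s \<in> set ts" "q \<in> set (labels s)"
      using OTree.prems(2) by auto
    obtain as bs where ts: "ts = as @ s # bs"
      and others: "\<forall>t\<in>set as \<union> set bs. q \<notin> set (labels t)"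
      using distinct_labels_split[OF OTree.prems(1) s(1)] s(2) by metis
    have "map (graft q k x) as = as" "map (graft q k x) bs = bs"
      using others by (auto intro!: map_idI graft_notin)
    then have graft: "graft q k x (OTree u ts) = OTree u (as @ graft q k x s # bs)"
      using False by (simp add: ts)
    note IH = OTree.IH[OF s(1) distinct_labels_subtree[OF OTree.prems(1) s(1)] s(2)]
    have "mset (labels (graft q k x (OTree u ts))) = add_mset x (mset (labels (OTree u ts)))"
      using IH unfolding graft by (simp add: ts)
    moreover have "increasing (graft q k x (OTree u ts))" if "increasing (OTree u ts)" "q < x"
      using IH that unfolding graft by (auto simp: ts)
    moreover have "children (graft q k x (OTree u ts)) v
        = ((children (OTree u ts))(q := take k (children (OTree u ts) q) @ x # drop k (children (OTree u ts) q))) v"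
      for v
    proof (cases "v = q")
      case True
      have "children (graft q k x (OTree u ts)) q = children (graft q k x s) q"
        unfolding graft using False others concat_map_single[of as bs "\<lambda>t. children t q"]
        by (simp add: children_notin)
      then show ?thesis
        using True IH children_subtree[OF OTree.prems(1) s] by simp
    next
      case v: False
      then show ?thesis
        using IH unfolding graft by (simp add: ts)
    qed
    ultimately show ?thesis
      by blast
  qed
qed

lemma graft_in_increasing_ordered_trees:
  assumes "t \<in> increasing_ordered_trees n" and "q \<le> n"
  shows "graft q k (Suc n) t \<in> increasing_ordered_trees (Suc n)"
    and "children (graft q k (Suc n) t)
      = (children t)(q := take k (children t q) @ Suc n # drop k (children t q))"
proof -
  note t = increasing_ordered_treesD[OF assms(1)]
  have q: "q \<in> set (labels t)" and new: "Suc n \<notin> set (labels t)"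
    using t(3) assms(2) by simp_all
  note graft = graft_properties[OF t(2) q, of k "Suc n"]
  have "distinct (labels (graft q k (Suc n) t))"
    using mset_eq_imp_distinct_iff[of "labels (graft q k (Suc n) t)" "Suc n # labels t"]
      graft t(2) new by simp
  moreover have "set (labels (graft q k (Suc n) t)) = insert (Suc n) (set (labels t))"
    using graft by (metis mset.simps(2) set_mset_mset list.simps(15))
  ultimately show "graft q k (Suc n) t \<in> increasing_ordered_trees (Suc n)"
    using graft t(1) assms(2) t(3)
    by (auto simp: increasing_ordered_trees_def)
  show "children (graft q k (Suc n) t)
      = (children t)(q := take k (children t q) @ Suc n # drop k (children t q))"
    using graft by blast
qed

text \<open>
  A tree for a family of size \<open>n + 1\<close> is found by deleting the largest label, which leaves a family of
  size \<open>n\<close>, and grafting it again onto a tree for that family.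
\<close>

lemma child_families_realised: "c \<in> child_families n \<Longrightarrow> \<exists>t\<in>increasing_ordered_trees n. children t = c"
proof (induction n arbitrary: c)
  case 0
  then have "children (OTree 0 []) = c"
    by (auto simp: child_families_0 fun_eq_iff)
  moreover have "OTree 0 [] \<in> increasing_ordered_trees 0"
    by (simp add: increasing_ordered_trees_def)
  ultimately show ?case
    by blast
next
  case (Suc n)
  obtain d q as bs where d: "d \<in> child_families n" and q: "q \<le> n" "d q = as @ bs"
    and c: "c = d(q := as @ Suc n # bs)"
    using child_families_remove_new[OF Suc.prems] .
  obtain t where t: "t \<in> increasing_ordered_trees n" "children t = d"
    using Suc.IH[OF d] by blast
  have "children (graft q (length as) (Suc n) t) = c"
    using graft_in_increasing_ordered_trees(2)[OF t(1) q(1)] q(2) by (simp add: t(2) c)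
  then show ?case
    using graft_in_increasing_ordered_trees(1)[OF t(1) q(1)] by blast
qed

lemma bij_betw_children: "bij_betw children (increasing_ordered_trees n) (child_families n)"
  unfolding bij_betw_def
  using inj_on_children children_in_child_families child_families_realised by blast

text \<open>
  The associate is the minimum of the cohort, and a minimum lies below \<open>c\<close> exactly if some element
  does.
\<close>

lemma klazar_violator_iff:
  assumes t: "t \<in> increasing_ordered_trees n" and v: "v \<in> set (labels t)"
  shows "klazar_violator t v \<longleftrightarrow> v \<in> violators (children t)"
proof -
  note D = increasing_ordered_treesD[OF t]
  have fam: "children t \<in> child_families n"
    using t by (rule children_in_child_families)
  have cohort: "cohort (children t) v = set (big_cohort t v)"
  proof (cases "v = root_label t")
    case True
    then have "cohort (children t) v = {}"
      using cohort_nonempty_range(1)[OF fam, of v] D(4) by auto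
    then show ?thesis
      using True left_siblings_root[OF D(2)] by (simp add: big_cohort_def)
  next
    case False
    then obtain p where "v \<in> set (children t p)"
      using parent_exists[OF D(2) v] by blast
    then show ?thesis
      using left_siblings_eq[OF D(2)] cohort_eq[OF fam] by (simp add: big_cohort_def)
  qed
  have "descent_terminator t v \<longleftrightarrow> big_cohort t v \<noteq> []"
    using v by (cases "left_siblings t v" rule: rev_cases) (auto simp: descent_terminator_def big_cohort_def)
  then show ?thesis
    by (auto simp: klazar_violator_def associate_def violators_def cohort Min_less_iff)
qed

lemma counted_by_stat_poly_trees:
  "counted_by_stat_poly increasing_ordered_trees num_klazar_violators"
proof (rule counted_by_stat_poly_bij)
  show "counted_by_stat_poly child_families (\<lambda>c. card (violators c))"
    by (rule counted_by_stat_poly_child_families)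
  show "bij_betw (inv_into (increasing_ordered_trees n) children) (child_families n)
      (increasing_ordered_trees n)" for n
    by (rule bij_betw_inv_into[OF bij_betw_children])
  fix n c assume c: "c \<in> child_families n"
  define t where "t = inv_into (increasing_ordered_trees n) children c"
  have t: "t \<in> increasing_ordered_trees n" and ct: "children t = c"
    using c bij_betw_children[of n] unfolding t_def
    by (metis bij_betw_imp_surj_on inv_into_into, metis bij_betw_inv_into_right)
  have "{v \<in> set (labels t). klazar_violator t v} = {v \<in> set (labels t). v \<in> violators c}"
    using klazar_violator_iff[OF t] ct by blast
  also have "\<dots> = violators c"
    using violators_subset_busy[OF c] busy_subset[OF c] increasing_ordered_treesD(3)[OF t] by auto
  finally show "num_klazar_violators (inv_into (increasing_ordered_trees n) children c) = card (violators c)"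
    by (simp add: num_klazar_violators_def t_def)
qed

section \<open>Equidistribution and generating function\<close>

theorem corollary17:
  shows "equidistributed increasing_ordered_trees num_klazar_violators
           perfect_matchings num_uplines
       \<and> equidistributed perfect_matchings num_uplines
           trapezoidal_words num_even_odd_times
       \<and> stat_gf increasing_ordered_trees num_klazar_violators = closed_form_gf
       \<and> stat_gf perfect_matchings num_uplines = closed_form_gf
       \<and> stat_gf trapezoidal_words num_even_odd_times = closed_form_gf"
  using counted_by_stat_poly_trees counted_by_stat_poly_matchings counted_by_stat_poly_words
  by (blast intro: equidistributed_if_counted_by_stat_poly stat_gf_eq_closed_form_gf)

end
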